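(* $\hat h_n^{\{d\}}\in\mathbb Z[\tilde h_k\mid k>0]$ for all $n>0$. In particular $(x_0^+)^{(k)}(x_1^-)^{(l)}\in\widetilde{\mathcal U}_{\mathbb Z}^-\widetilde{\mathcal U}_{\mathbb Z}^0\widetilde{\mathcal U}_{\mathbb Z}^+$ for all $k,l\in\mathbb N$.
   Context: $\mathbb N=\{0,1,2,\dots\}$, $\mathbb Z_+=\{1,2,\dots\}$. For $a$ in a unital $\mathbb Q$-algebra: $a^{(k)}=a^k/k!$, $\binom ak=a(a-1)\cdots(a-k+1)/k!$. The Lie algebra of type $A_2^{(2)}$ (and its enveloping algebra $\widetilde{\mathcal U}$, as associative algebra) is generated over $\mathbb Q$ by $\{c,h_r,x_r^\pm,X_{2r+1}^\pm\mid r\in\mathbb Z\}$ (a basis of the Lie algebra) with relations: $c$ central; $[h_r,h_s]=\delta_{r+s,0}\,2r(2+(-1)^{r-1})c$; $[h_r,x_s^\pm]=\pm2(2+(-1)^{r-1})x_{r+s}^\pm$; for $s$ odd, $[h_r,X_s^\pm]=\pm4X_{r+s}^\pm$ if $r$ is even and $0$ if $r$ is odd; $[x_r^\pm,x_s^\pm]=0$ if $r+s$ is even and $\pm(-1)^sX_{r+s}^\pm$ if $r+s$ is odd; $[x_r^\pm,X_s^\pm]=[X_r^\pm,X_s^\pm]=0$; $[x_r^+,x_s^-]=h_{r+s}+\delta_{r+s,0}\,rc$; $[x_r^\pm,X_s^\mp]=\pm(-1)^r4x_{r+s}^\mp$ ($s$ odd); $[X_r^+,X_s^-]=8h_{r+s}+4\delta_{r+s,0}\,rc$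 ($r,s$ odd). Define $\varepsilon_r=-1$ if $4\mid r$ and $\varepsilon_r=1$ otherwise, and $\tilde h_{\pm k}$ by $\sum_{k\ge0}\tilde h_{\pm k}u^k=\exp\big(\sum_{r>0}(-1)^{r-1}\frac{\varepsilon_rh_{\pm r}}{r}u^r\big)$. $d:\mathbb Z_+\to\mathbb Q$ is defined by $\sum_{n>0}(-1)^{n-1}\frac{d_n}{n}u^n=\frac12\ln(1+2u-u^2)$, and $\hat h_n^{\{d\}}$ by $\sum_{n\ge0}\hat h_n^{\{d\}}u^n=\exp\big(\sum_{r>0}(-1)^{r-1}\frac{d_rh_r}{r}u^r\big)$. $\widetilde{\mathcal U}_{\mathbb Z}^\pm$ is the $\mathbb Z$-subalgebra of $\widetilde{\mathcal U}$ generated by $(x_r^\pm)^{(k)}$ ($r\in\mathbb Z,k\in\mathbb N$); $\widetilde{\mathcal U}_{\mathbb Z}^0$ is the $\mathbb Z$-subalgebra generated by $\tilde h_{k},\tilde h_{-k}$ ($k>0$) and $\binom{h_0}{k},\binom ck$ ($k\in\mathbb N$). Products of subalgebras denote the $\mathbb Z$-span of products of elements. *)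

theory Defs
  imports
    "HOL-Library.Poly_Mapping"
    "HOL-Computational_Algebra.Formal_Power_Series"
begin

unbundle fps_syntax

section \<open>Unital associative algebras over the rationals\<close>

class rat_algebra_1 = ring_1 +
  fixes scaleQ :: "rat \<Rightarrow> 'a \<Rightarrow> 'a" (infixr "*\<^sub>Q" 75)
  assumes scaleQ_add_right: "q *\<^sub>Q (x + y) = q *\<^sub>Q x + q *\<^sub>Q y"
    and scaleQ_add_left: "(p + q) *\<^sub>Q x = p *\<^sub>Q x + q *\<^sub>Q x"
    and scaleQ_scaleQ: "p *\<^sub>Q (q *\<^sub>Q x) = (p * q) *\<^sub>Q x"
    and scaleQ_one: "1 *\<^sub>Q x = x"
    and mult_scaleQ_left: "(q *\<^sub>Q x) * y = q *\<^sub>Q (x * y)"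
    and mult_scaleQ_right: "x * (q *\<^sub>Q y) = q *\<^sub>Q (x * y)"

definition divpow :: "'a::rat_algebra_1 \<Rightarrow> nat \<Rightarrow> 'a" where
  "divpow a k = (1 / fact k) *\<^sub>Q (a ^ k)"

text \<open>The library's \<open>gbinomial\<close> needs a commutative ring with division, hence this version.\<close>

definition binomQ :: "'a::rat_algebra_1 \<Rightarrow> nat \<Rightarrow> 'a" where
  "binomQ a k = (1 / fact k) *\<^sub>Q prod_list (map (\<lambda>i. a - of_nat i) [0..<k])"

text \<open>
  The exponential \<open>\<Sum>k. F^k / k!\<close> of a power series \<open>F\<close> without constant term; for
  such \<open>F\<close> the series \<open>F ^ k\<close> has no terms of degree below \<open>k\<close>, so each
  coefficient is the finite sum below.
\<close>

definition fps_expQ :: "'a::rat_algebra_1 fps \<Rightarrow> 'a fps" where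
  "fps_expQ F = Abs_fps (\<lambda>n. \<Sum>k\<le>n. (1 / fact k) *\<^sub>Q ((F ^ k) $ n))"

definition hhat :: "(nat \<Rightarrow> rat) \<Rightarrow> (nat \<Rightarrow> 'a::rat_algebra_1) \<Rightarrow> nat \<Rightarrow> 'a" where
  "hhat a p n = fps_expQ (Abs_fps (\<lambda>r. if r = 0 then 0
     else ((-1) ^ (r - 1) * a r / of_nat r) *\<^sub>Q p r)) $ n"

inductive_set zsubalg :: "'a::ring_1 set \<Rightarrow> 'a set" for S where
  base: "a \<in> S \<Longrightarrow> a \<in> zsubalg S"
| one: "1 \<in> zsubalg S"
| diff: "a \<in> zsubalg S \<Longrightarrow> b \<in> zsubalg S \<Longrightarrow> a - b \<in> zsubalg S"
| mult: "a \<in> zsubalg S \<Longrightarrow> b \<in> zsubalg S \<Longrightarrow> a * b \<in> zsubalg S"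

inductive_set zspan :: "'a::ab_group_add set \<Rightarrow> 'a set" for S where
  zero: "0 \<in> zspan S"
| base: "a \<in> S \<Longrightarrow> a \<in> zspan S"
| diff: "a \<in> zspan S \<Longrightarrow> b \<in> zspan S \<Longrightarrow> a - b \<in> zspan S"

definition zprod :: "'a::ring_1 set \<Rightarrow> 'a set \<Rightarrow> 'a set" where
  "zprod A B = zspan {a * b | a b. a \<in> A \<and> b \<in> B}"


section \<open>The enveloping algebra of type \<open>A\<^sub>2\<^sup>(\<^sup>2\<^sup>)\<close>\<close>

datatype pm = Pos | Neg

fun opp :: "pm \<Rightarrow> pm" where
  "opp Pos = Neg"
| "opp Neg = Pos"

fun sg :: "pm \<Rightarrow> rat" where
  "sg Pos = 1"
| "sg Neg = -1"

text \<open>\<open>GBigX \<sigma> j\<close> stands for the generator \<open>X\<close> of odd index \<open>2 * j + 1\<close>.\<close>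

datatype gen = GC | GH int | GX pm int | GBigX pm int

text \<open>
  The free unital algebra on the generators is the monoid algebra over the rationals of the free
  monoid of words. The wrapper type is needed because the convolution product of
  \<open>poly_mapping\<close> expects an additively written monoid.
\<close>

datatype word = Word "gen list"

instantiation word :: monoid_add
begin
definition zero_word :: word where "zero_word = Word []"
fun plus_word :: "word \<Rightarrow> word \<Rightarrow> word" where "Word u + Word v = Word (u @ v)"
instance
proof
  fix a b c :: word
  show "a + b + c = a + (b + c)" by (cases a; cases b; cases c) simp
  show "0 + a = a" "a + 0 = a" by (cases a; simp add: zero_word_def)+
qed
end

type_synonym free_alg = "word \<Rightarrow>\<^sub>0 rat"

definition fgen :: "gen \<Rightarrow> free_alg" where
  "fgen g = Poly_Mapping.single (Word [g]) 1"

definition fconst :: "rat \<Rightarrow> free_alg" where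
  "fconst q = Poly_Mapping.single 0 q"

definition fcomm :: "free_alg \<Rightarrow> free_alg \<Rightarrow> free_alg" where
  "fcomm a b = a * b - b * a"

abbreviation fC :: free_alg where "fC \<equiv> fgen GC"
abbreviation fH :: "int \<Rightarrow> free_alg" where "fH r \<equiv> fgen (GH r)"
abbreviation fX :: "pm \<Rightarrow> int \<Rightarrow> free_alg" where "fX \<sigma> r \<equiv> fgen (GX \<sigma> r)"

text \<open>The generator \<open>X\<close> of index \<open>s\<close>; only used for odd \<open>s\<close>.\<close>

abbreviation fBigX :: "pm \<Rightarrow> int \<Rightarrow> free_alg" where
  "fBigX \<sigma> s \<equiv> fgen (GBigX \<sigma> ((s - 1) div 2))"

text \<open>A relation \<open>a = b\<close> is represented by the element \<open>a - b\<close>.\<close>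

inductive_set relators :: "free_alg set" where
  c_central: "fcomm fC (fgen g) \<in> relators"
| h_h: "fcomm (fH r) (fH s)
    - (if r + s = 0 then fconst (2 * of_int r * (2 + (-1) powi (r - 1))) * fC else 0) \<in> relators"
| h_x: "fcomm (fH r) (fX \<sigma> s)
    - fconst (sg \<sigma> * 2 * (2 + (-1) powi (r - 1))) * fX \<sigma> (r + s) \<in> relators"
| h_X: "odd s \<Longrightarrow> fcomm (fH r) (fBigX \<sigma> s)
    - (if even r then fconst (sg \<sigma> * 4) * fBigX \<sigma> (r + s) else 0) \<in> relators"
| x_x: "fcomm (fX \<sigma> r) (fX \<sigma> s)
    - (if even (r + s) then 0 else fconst (sg \<sigma> * (-1) powi s) * fBigX \<sigma> (r + s)) \<in> relators"
| x_X: "odd s \<Longrightarrow> fcomm (fX \<sigma> r) (fBigX \<sigma> s) \<in> relators"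
| X_X: "odd r \<Longrightarrow> odd s \<Longrightarrow> fcomm (fBigX \<sigma> r) (fBigX \<sigma> s) \<in> relators"
| xp_xm: "fcomm (fX Pos r) (fX Neg s)
    - (fH (r + s) + (if r + s = 0 then fconst (of_int r) * fC else 0)) \<in> relators"
| x_Xopp: "odd s \<Longrightarrow> fcomm (fX \<sigma> r) (fBigX (opp \<sigma>) s)
    - fconst (sg \<sigma> * (-1) powi r * 4) * fX (opp \<sigma>) (r + s) \<in> relators"
| Xp_Xm: "odd r \<Longrightarrow> odd s \<Longrightarrow> fcomm (fBigX Pos r) (fBigX Neg s)
    - (fconst 8 * fH (r + s) + (if r + s = 0 then fconst (4 * of_int r) * fC else 0)) \<in> relators"

text \<open>The two-sided ideal generated by the relators.\<close>

inductive_set rel_ideal :: "free_alg set" where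
  zero: "0 \<in> rel_ideal"
| base: "a \<in> relators \<Longrightarrow> a \<in> rel_ideal"
| add: "a \<in> rel_ideal \<Longrightarrow> b \<in> rel_ideal \<Longrightarrow> a + b \<in> rel_ideal"
| left: "a \<in> rel_ideal \<Longrightarrow> p * a \<in> rel_ideal"
| right: "a \<in> rel_ideal \<Longrightarrow> a * p \<in> rel_ideal"

lemma rel_ideal_uminus: "a \<in> rel_ideal \<Longrightarrow> - a \<in> rel_ideal"
  using rel_ideal.left[of a "-1"] by simp

lemma rel_ideal_diff: "a \<in> rel_ideal \<Longrightarrow> b \<in> rel_ideal \<Longrightarrow> a - b \<in> rel_ideal"
  using rel_ideal.add[of a "- b"] rel_ideal_uminus[of b] by simp

definition rel_equiv :: "free_alg \<Rightarrow> free_alg \<Rightarrow> bool" where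
  "rel_equiv a b \<longleftrightarrow> a - b \<in> rel_ideal"

quotient_type ualg = free_alg / rel_equiv
proof (rule equivpI)
  show "reflp rel_equiv"
    by (auto simp: reflp_def rel_equiv_def rel_ideal.zero)
  show "symp rel_equiv"
    by (rule sympI) (metis rel_equiv_def rel_ideal_uminus minus_diff_eq)
  show "transp rel_equiv"
  proof (rule transpI)
    fix a b c assume "rel_equiv a b" "rel_equiv b c"
    then have "(a - b) + (b - c) \<in> rel_ideal"
      unfolding rel_equiv_def by (rule rel_ideal.add)
    then show "rel_equiv a c" by (simp add: rel_equiv_def)
  qed
qed

text \<open>
  In \<open>ring_1\<close> one has to be different from zero, so properness of the ideal is needed: it is
  contained in the augmentation ideal.
\<close>

lemma word_add_eq_0: "(u::word) + v = 0 \<longleftrightarrow> u = 0 \<and> v = 0"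
  by (cases u; cases v) (simp add: zero_word_def)

lemma lookup_times_0:
  fixes p q :: free_alg
  assumes "Poly_Mapping.lookup p 0 = 0 \<or> Poly_Mapping.lookup q 0 = 0"
  shows "Poly_Mapping.lookup (p * q) 0 = 0"
proof -
  have zero: "Poly_Mapping.lookup q v = 0" if "0 = u + v" "Poly_Mapping.lookup p u \<noteq> 0" for u v
  proof -
    have "u = 0" "v = 0" using word_add_eq_0[of u v] that(1) by auto
    then show ?thesis using that(2) assms by auto
  qed
  have *: "Poly_Mapping.lookup p u * (\<Sum>v. Poly_Mapping.lookup q v when 0 = u + v) = 0" for u
  proof (cases "Poly_Mapping.lookup p u = 0")
    case False
    then have "(\<lambda>v. Poly_Mapping.lookup q v when 0 = u + v) = (\<lambda>v. 0)"
      using zero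
      by (auto simp: when_def)
    then show ?thesis by (simp only: Sum_any.neutral mult_zero_right)
  qed simp
  show ?thesis
    unfolding times_poly_mapping.rep_eq prod_fun_def * by simp
qed

lemma lookup_fgen_0: "Poly_Mapping.lookup (fgen g) 0 = 0"
  by (simp add: fgen_def lookup_single zero_word_def)

lemma lookup_rel_ideal_0: "a \<in> rel_ideal \<Longrightarrow> Poly_Mapping.lookup a 0 = 0"
proof (induction rule: rel_ideal.induct)
  case (base a)
  then show ?case
    by cases (simp_all add: fcomm_def lookup_minus lookup_add lookup_times_0 lookup_fgen_0)
qed (auto simp: lookup_add lookup_times_0)

lemma one_notin_rel_ideal: "1 \<notin> rel_ideal"
  using lookup_rel_ideal_0[of 1] by (auto simp: lookup_one)

instantiation ualg :: rat_algebra_1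
begin

lift_definition zero_ualg :: ualg is 0 .
lift_definition one_ualg :: ualg is 1 .
lift_definition plus_ualg :: "ualg \<Rightarrow> ualg \<Rightarrow> ualg" is "(+)"
proof -
  fix a a' b b' assume "rel_equiv a a'" "rel_equiv b b'"
  then have "(a - a') + (b - b') \<in> rel_ideal"
    unfolding rel_equiv_def by (rule rel_ideal.add)
  then show "rel_equiv (a + b) (a' + b')"
    by (simp add: rel_equiv_def algebra_simps)
qed
lift_definition uminus_ualg :: "ualg \<Rightarrow> ualg" is uminus
proof -
  fix a a' assume "rel_equiv a a'"
  then have "- (a - a') \<in> rel_ideal"
    unfolding rel_equiv_def by (rule rel_ideal_uminus)
  then show "rel_equiv (- a) (- a')"
    by (simp add: rel_equiv_def)
qed
lift_definition minus_ualg :: "ualg \<Rightarrow> ualg \<Rightarrow> ualg" is "(-)"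
proof -
  fix a a' b b' assume "rel_equiv a a'" "rel_equiv b b'"
  then have "(a - a') - (b - b') \<in> rel_ideal"
    unfolding rel_equiv_def by (rule rel_ideal_diff)
  then show "rel_equiv (a - b) (a' - b')"
    by (simp add: rel_equiv_def algebra_simps)
qed
lift_definition times_ualg :: "ualg \<Rightarrow> ualg \<Rightarrow> ualg" is "(*)"
proof -
  fix a a' b b' assume "rel_equiv a a'" "rel_equiv b b'"
  then have "(a - a') * b + a' * (b - b') \<in> rel_ideal"
    unfolding rel_equiv_def by (intro rel_ideal.add rel_ideal.left rel_ideal.right)
  then show "rel_equiv (a * b) (a' * b')"
    by (simp add: rel_equiv_def algebra_simps)
qed
lift_definition scaleQ_ualg :: "rat \<Rightarrow> ualg \<Rightarrow> ualg" is "\<lambda>q a. fconst q * a"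
proof -
  fix q a a' assume "rel_equiv a a'"
  then have "fconst q * (a - a') \<in> rel_ideal"
    unfolding rel_equiv_def by (rule rel_ideal.left)
  then show "rel_equiv (fconst q * a) (fconst q * a')"
    by (simp add: rel_equiv_def algebra_simps)
qed

lemma fconst_commute: "a * fconst q = fconst q * a"
proof (induction a rule: update_induct)
  case const
  then show ?case by simp
next
  case (update f k v)
  have "Poly_Mapping.update k v f = f + Poly_Mapping.single k v"
    using update(1) by (intro poly_mapping_eqI)
      (auto simp: lookup_update lookup_add lookup_single in_keys_iff when_def)
  moreover have "Poly_Mapping.single k v * fconst q = fconst q * Poly_Mapping.single k v"
    by (simp add: fconst_def mult_single mult.commute)
  ultimately show ?case by (simp add: update.IH algebra_simps)
qed

instance
proof
  fix a b c :: ualg and p q :: rat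
  note defs = rel_equiv_def rel_ideal.zero algebra_simps
  show "a * b * c = a * (b * c)" by transfer (simp add: defs)
  show "a + b + c = a + (b + c)" by transfer (simp add: defs)
  show "a + b = b + a" by transfer (simp add: defs)
  show "0 + a = a" by transfer (simp add: defs)
  show "- a + a = 0" by transfer (simp add: defs)
  show "a - b = a + - b" by transfer (simp add: defs)
  show "1 * a = a" by transfer (simp add: defs)
  show "a * 1 = a" by transfer (simp add: defs)
  show "(a + b) * c = a * c + b * c" by transfer (simp add: defs)
  show "a * (b + c) = a * b + a * c" by transfer (simp add: defs)
  show "(0::ualg) \<noteq> 1"
    by transfer (use rel_ideal_uminus[of "- 1"] one_notin_rel_ideal in \<open>auto simp: rel_equiv_def\<close>)
  show "q *\<^sub>Q (a + b) = q *\<^sub>Q a + q *\<^sub>Q b" by transfer (simp add: defs)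
  show "(p + q) *\<^sub>Q a = p *\<^sub>Q a + q *\<^sub>Q a"
    by transfer (simp add: fconst_def single_add defs)
  show "p *\<^sub>Q (q *\<^sub>Q a) = (p * q) *\<^sub>Q a"
    by transfer (simp add: fconst_def mult_single rel_equiv_def rel_ideal.zero flip: mult.assoc)
  show "1 *\<^sub>Q a = a" by transfer (simp add: fconst_def defs)
  show "(q *\<^sub>Q a) * b = q *\<^sub>Q (a * b)" by transfer (simp add: defs)
  show "a * (q *\<^sub>Q b) = q *\<^sub>Q (a * b)"
  proof transfer
    fix a b q
    have "a * (fconst q * b) = fconst q * (a * b)"
      by (metis fconst_commute mult.assoc)
    then show "rel_equiv (a * (fconst q * b)) (fconst q * (a * b))"
      by (simp add: rel_equiv_def rel_ideal.zero)
  qed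
qed

end

lift_definition ugen :: "gen \<Rightarrow> ualg" is fgen .

abbreviation c_elt :: ualg where "c_elt \<equiv> ugen GC"
abbreviation h_elt :: "int \<Rightarrow> ualg" where "h_elt r \<equiv> ugen (GH r)"
abbreviation x_elt :: "pm \<Rightarrow> int \<Rightarrow> ualg" where "x_elt \<sigma> r \<equiv> ugen (GX \<sigma> r)"


section \<open>The coefficient sequences and the integral subalgebras\<close>

definition eps :: "nat \<Rightarrow> rat" where
  "eps r = (if 4 dvd r then -1 else 1)"

definition htilde_pos :: "nat \<Rightarrow> ualg" where
  "htilde_pos k = hhat eps (\<lambda>r. h_elt (int r)) k"

definition htilde_neg :: "nat \<Rightarrow> ualg" where
  "htilde_neg k = hhat eps (\<lambda>r. h_elt (- int r)) k"

definition half_log_series :: "rat fps" where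
  "half_log_series = fps_const (1/2) * (fps_ln 1 oo (2 * fps_X - fps_X ^ 2))"

text \<open>
  \<open>fps_ln 1\<close> is the series of \<open>ln (1 + u)\<close>. The defining equation of \<open>d\<close> is
  solved for the coefficients, see \<open>d_seq_generating\<close>; the value at \<open>0\<close> is irrelevant.
\<close>

definition d_seq :: "nat \<Rightarrow> rat" where
  "d_seq n = (-1) ^ (n - 1) * of_nat n * half_log_series $ n"

lemma d_seq_generating:
  "Abs_fps (\<lambda>n. if n = 0 then 0 else (-1) ^ (n - 1) * d_seq n / of_nat n) = half_log_series"
proof (rule fps_ext)
  fix n
  have "(-1) ^ (n - 1) * ((-1) ^ (n - 1) * x) = (x::rat)" for x
    by (simp flip: mult.assoc power_mult_distrib)
  then show "Abs_fps (\<lambda>n. if n = 0 then 0 else (-1) ^ (n - 1) * d_seq n / of_nat n) $ n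
      = half_log_series $ n"
    by (simp add: d_seq_def half_log_series_def mult.assoc)
qed

definition hhat_d :: "nat \<Rightarrow> ualg" where
  "hhat_d n = hhat d_seq (\<lambda>r. h_elt (int r)) n"

definition UZ_pm :: "pm \<Rightarrow> ualg set" where
  "UZ_pm \<sigma> = zsubalg {divpow (x_elt \<sigma> r) k | r k. True}"

definition UZ_0 :: "ualg set" where
  "UZ_0 = zsubalg ({htilde_pos k | k. k > 0} \<union> {htilde_neg k | k. k > 0}
     \<union> {binomQ (h_elt 0) k | k. True} \<union> {binomQ c_elt k | k. True})"

end

(*
  The real root vectors x_0^+ and x_1^- generate a twisted loop algebra in nonnegative degrees, and
  exp(x_0^+ u) exp(x_1^- v) has a Gauss decomposition N^- H N^+ that can be read off from 3x3
  matrices: with w = uv and f = 1 + 2w - w^2 the diagonal part is exp(sum of the h_r with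
  coefficients those of (1/2) ln f), and the x^+ part has coefficient series (1-w)/f. Both sides
  solve the same differential equation in v, which reduces the identity to relations between
  rational functions of w. All series occurring in N^- and N^+ have integer coefficients.

  For the integrality of H, write the generating series of the htilde_k as the product of the
  1 + c_k u^k. The c_k lie in Z[htilde_k], and the generating series of the hhat_n becomes the
  product of g_k(c_k u^k), where g_k is a series in one variable over Q. With
  d_n = ((1 + sqrt 2)^n + (1 - sqrt 2)^n) / 2 the series g_k is a square root or a fourth root of a
  rational function, and it is integral by congruences modulo 4.
*)

theory Submission
  imports Defs
begin

section \<open>Exponentials over noncommutative algebras\<close>

text \<open>Root vectors \<open>x_r\<close>, \<open>x_s\<close> of the same sign commute only if
  \<open>r + s\<close> is even. Each unipotent factor is therefore a product of three exponentials,
  over the even-indexed \<open>x\<close>, the \<open>X\<close> and the odd-indexed \<open>x\<close>.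
  Inside each of them everything commutes, so integrality reduces to divided powers. This is why
  \<open>(1-w)/f\<close> is split into its even and odd parts and why a third series, for the
  \<open>X\<close>, appears.

  The differential equation needs the derivation that multiplies an element of loop degree
  \<open>r\<close> by \<open>r\<close>. Instead of being constructed on the quotient algebra, it is
  obtained by attaching \<open>p^r\<close> to such an element, for a formal variable
  \<open>p\<close>: it becomes \<open>p d/dp\<close>.

  In the diagonal part the signs \<open>eps\<close> are decisive. With all signs 1, the factor
  \<open>g_1\<close> would be the square root of \<open>1 + 2u - u^2\<close>, whose coefficient at
  \<open>u^4\<close> is -3/2. The sign change at the multiples of 4 multiplies it by the fourth root
  of a rational function of \<open>u^4\<close>, which repairs this.\<close>

global_interpretation ratvs: vector_space "scaleQ :: rat \<Rightarrow> 'a::rat_algebra_1 \<Rightarrow> 'a"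
  by unfold_locales (simp_all add: scaleQ_add_right scaleQ_add_left scaleQ_scaleQ scaleQ_one)

lemma scaleQ_of_nat: "of_nat n *\<^sub>Q x = of_nat n * (x::'a::rat_algebra_1)"
  by (induction n) (simp_all add: scaleQ_add_left algebra_simps)

lemma scaleQ_of_int: "of_int n *\<^sub>Q x = of_int n * (x::'a::rat_algebra_1)"
  by (cases n rule: int_cases2) (simp_all add: scaleQ_of_nat)

lemma scaleQ_power: "(q *\<^sub>Q x) ^ n = q ^ n *\<^sub>Q (x::'a::rat_algebra_1) ^ n"
  by (induction n) (simp_all add: mult_scaleQ_left mult_scaleQ_right)

lemmas mult_scaleQ [simp] = mult_scaleQ_left mult_scaleQ_right

instantiation rat :: rat_algebra_1
begin
definition scaleQ_rat :: "rat \<Rightarrow> rat \<Rightarrow> rat" where [simp]: "scaleQ_rat q x = q * x"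
instance by standard (simp_all add: algebra_simps)
end

instantiation fps :: (rat_algebra_1) rat_algebra_1
begin
definition scaleQ_fps :: "rat \<Rightarrow> 'a fps \<Rightarrow> 'a fps" where
  "scaleQ_fps q F = Abs_fps (\<lambda>n. q *\<^sub>Q (F $ n))"
instance
  by standard (simp_all add: scaleQ_fps_def fps_eq_iff fps_mult_nth scaleQ_add_left
      scaleQ_add_right ratvs.scale_sum_right)
end

lemma scaleQ_fps_nth [simp]: "(q *\<^sub>Q F) $ n = q *\<^sub>Q (F $ n)"
  by (simp add: scaleQ_fps_def)

lemma divpow_0 [simp]: "divpow x 0 = 1"
  by (simp add: divpow_def)

lemma divpow_Suc: "of_nat (Suc n) *\<^sub>Q divpow x (Suc n) = divpow x n * (x::'a::rat_algebra_1)"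
proof -
  have "of_nat (Suc n) * (1 / fact (Suc n)) = (1 / fact n :: rat)"
    by (simp add: fact_Suc del: of_nat_Suc)
  then show ?thesis
    by (simp add: divpow_def power_Suc2 del: power_Suc of_nat_Suc)
qed

lemma divpow_commute: "x * y = y * x \<Longrightarrow> divpow x n * y = y * divpow (x::'a::rat_algebra_1) n"
  by (simp add: divpow_def power_commuting_commutes)

lemma divpow_scaleQ: "divpow (q *\<^sub>Q x) n = q ^ n *\<^sub>Q divpow (x::'a::rat_algebra_1) n"
  by (simp add: divpow_def scaleQ_power mult.commute)

text \<open>Coefficient \<open>n\<close> of the equation determines \<open>n + 1\<close> times
  coefficient \<open>n + 1\<close> of the series, and over the rationals \<open>n + 1\<close> can be
  divided out. As \<open>y\<close> multiplies on the right throughout, the argument works in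
  noncommutative algebras.\<close>

lemma fps_deriv_unique:
  fixes F G :: "'a::rat_algebra_1 fps"
  assumes "fps_deriv F = F * fps_const y" "fps_deriv G = G * fps_const y" "F $ 0 = G $ 0"
  shows "F = G"
proof (rule fps_ext)
  fix n show "F $ n = G $ n"
  proof (induction n)
    case (Suc n)
    have "of_nat (Suc n) *\<^sub>Q (F $ Suc n) = of_nat (Suc n) *\<^sub>Q (G $ Suc n)"
      using arg_cong[OF assms(1), of "\<lambda>H. H $ n"] arg_cong[OF assms(2), of "\<lambda>H. H $ n"] Suc.IH
      by (simp add: scaleQ_of_nat del: of_nat_Suc)
    then show ?case by (simp del: of_nat_Suc)
  qed (use assms in simp)
qed

text \<open>
  \<open>expser y\<close> is \<open>exp (s * y)\<close> as a series in an auxiliary variable \<open>s\<close>, where identities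
  follow from uniqueness for \<open>F' = F * y\<close>; \<open>eval1\<close> transfers them to \<open>fps_expQ\<close> by setting \<open>s = 1\<close>.
\<close>

definition expser :: "'a::rat_algebra_1 \<Rightarrow> 'a fps" where
  "expser y = Abs_fps (divpow y)"

lemma expser_nth [simp]: "expser y $ n = divpow y n"
  by (simp add: expser_def)

lemma fps_deriv_expser: "fps_deriv (expser y) = expser y * fps_const y"
  by (simp add: fps_eq_iff divpow_Suc scaleQ_of_nat[symmetric] del: of_nat_Suc)

lemma expser_commute: "x * y = y * x \<Longrightarrow> expser x * fps_const y = fps_const y * expser x"
  by (simp add: fps_eq_iff divpow_commute)

lemma expser_add:
  assumes "x * y = y * x"
  shows "expser (x + y) = expser x * expser y"
proof (rule fps_deriv_unique[where y = "x + y"])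
  have "expser y * fps_const x = fps_const x * expser y"
    using assms by (intro expser_commute) simp
  then show "fps_deriv (expser x * expser y) = expser x * expser y * fps_const (x + y)"
    by (simp add: fps_deriv_expser distrib_left mult.assoc flip: fps_const_add)
qed (simp_all add: fps_deriv_expser)

text \<open>\<open>A k\<close> is the k-fold bracket of \<open>A 0\<close> with \<open>y\<close>, so
  this is \<open>exp(-y) A exp(y) = exp(-ad y) A\<close>. Both sides solve \<open>F' = F * y\<close>
  with initial value \<open>A 0\<close>.\<close>

lemma mult_expser:
  fixes A :: "nat \<Rightarrow> 'a::rat_algebra_1"
  assumes "\<And>k. A k * y - y * A k = A (Suc k)"
  shows "fps_const (A 0) * expser y = expser y * Abs_fps (\<lambda>k. (1 / fact k) *\<^sub>Q A k)"
    (is "_ = _ * ?A")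
proof (rule fps_deriv_unique[where y = y])
  have "of_nat (Suc n) *\<^sub>Q ((1 / fact (Suc n)) *\<^sub>Q A (Suc n)) = (1 / fact n) *\<^sub>Q A (Suc n)" for n
    by (simp add: fact_Suc del: of_nat_Suc)
  then have "fps_deriv ?A $ n = (1 / fact n) *\<^sub>Q A (Suc n)" for n
    unfolding fps_deriv_nth by (simp only: scaleQ_of_nat fps_nth_Abs_fps Suc_eq_plus1[symmetric])
  then have dA: "fps_deriv ?A = ?A * fps_const y - fps_const y * ?A"
    by (simp add: fps_eq_iff assms[symmetric] ratvs.scale_right_diff_distrib)
  show "fps_deriv (expser y * ?A) = expser y * ?A * fps_const y"
    by (simp only: fps_deriv_mult fps_deriv_expser dA) (simp add: algebra_simps)
qed (simp_all add: fps_deriv_expser mult.assoc)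

section \<open>Setting the auxiliary variable to 1\<close>

definition evaluable :: "'a::zero fps fps \<Rightarrow> bool" where
  "evaluable F \<longleftrightarrow> (\<forall>n m. m < n \<longrightarrow> F $ n $ m = 0)"

text \<open>For an \<open>evaluable\<close> series the coefficient of \<open>s^n\<close> starts in
  degree \<open>n\<close>, so in degree \<open>m\<close> the value at \<open>s = 1\<close> is this
  finite sum.\<close>

definition eval1 :: "'a::comm_monoid_add fps fps \<Rightarrow> 'a fps" where
  "eval1 F = Abs_fps (\<lambda>m. \<Sum>n\<le>m. F $ n $ m)"

lemma eval1_nth: "evaluable F \<Longrightarrow> m \<le> N \<Longrightarrow> eval1 F $ m = (\<Sum>n\<le>N. F $ n $ m)"
  unfolding eval1_def evaluable_def
  by (auto intro!: sum.mono_neutral_left simp: not_le[symmetric])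

lemma fps_mult_nth_low:
  fixes F G :: "'a::semiring_0 fps"
  assumes "\<And>i. i < a \<Longrightarrow> F $ i = 0" "\<And>i. i < b \<Longrightarrow> G $ i = 0" "m < a + b"
  shows "(F * G) $ m = 0"
  unfolding fps_mult_nth
proof (intro sum.neutral ballI)
  fix i assume "i \<in> {0..m}"
  then have "i < a \<or> m - i < b" using assms(3) by auto
  then show "F $ i * G $ (m - i) = 0" using assms(1,2) by auto
qed

lemma evaluable_mult:
  fixes F G :: "'a::semiring_0 fps fps"
  assumes "evaluable F" "evaluable G"
  shows "evaluable (F * G)"
  unfolding evaluable_def
proof (intro allI impI)
  fix n m :: nat assume "m < n"
  then have "(F $ i * G $ (n - i)) $ m = 0" if "i \<le> n" for i
    using assms that by (intro fps_mult_nth_low[where a = i and b = "n - i"]) (auto simp: evaluable_def)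
  then show "(F * G) $ n $ m = 0" by (simp add: fps_mult_nth fps_sum_nth)
qed

lemma evaluable_const [simp]: "evaluable (fps_const A)"
  by (simp add: evaluable_def)

lemma eval1_const [simp]: "eval1 (fps_const A) = A"
  by (rule fps_ext) (simp add: eval1_def if_distrib[of "\<lambda>F. F $ _"] cong: if_cong)

lemma eval1_mult:
  fixes F G :: "'a::semiring_0 fps fps"
  assumes "evaluable F" "evaluable G"
  shows "eval1 (F * G) = eval1 F * eval1 G"
proof (rule fps_ext)
  fix m
  \<comment> \<open>With the bound \<open>2*m\<close> the triangle of pairs
    \<open>i + j \<le> 2*m\<close> contains the square of pairs up to \<open>m\<close>; outside the
    square the summands vanish in degree \<open>m\<close>.\<close>
  have "eval1 (F * G) $ m = (\<Sum>n\<le>2*m. \<Sum>i\<le>n. (F $ i * G $ (n - i)) $ m)"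
    by (subst eval1_nth[where N = "2*m"])
      (simp_all add: evaluable_mult assms fps_mult_nth[of F G] fps_sum_nth atMost_atLeast0)
  also have "\<dots> = (\<Sum>(i,j) | i + j \<le> 2*m. (F $ i * G $ j) $ m)"
    by (rule sum.triangle_reindex_eq[symmetric])
  also have "\<dots> = (\<Sum>(i,j) \<in> {..m} \<times> {..m}. (F $ i * G $ j) $ m)"
  proof (rule sum.mono_neutral_right)
    show "finite {(i, j). i + j \<le> 2 * m}"
      by (rule finite_subset[of _ "{..2*m} \<times> {..2*m}"]) auto
    have "(F $ i * G $ j) $ m = 0" if "\<not> (i \<le> m \<and> j \<le> m)" for i j
      using assms that
      by (intro fps_mult_nth_low[where a = i and b = j]) (auto simp: evaluable_def)
    then show "\<forall>p\<in>{(i, j). i + j \<le> 2 * m} - {..m} \<times> {..m}. (case p of (i, j) \<Rightarrow> (F $ i * G $ j) $ m) = 0"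
      by auto
  qed auto
  also have "\<dots> = (\<Sum>i\<le>m. \<Sum>j\<le>m. \<Sum>k=0..m. F $ i $ k * G $ j $ (m - k))"
    by (subst sum.cartesian_product[symmetric]) (simp add: fps_mult_nth)
  also have "\<dots> = (\<Sum>i\<le>m. \<Sum>k=0..m. \<Sum>j\<le>m. F $ i $ k * G $ j $ (m - k))"
    by (intro sum.cong refl sum.swap)
  also have "\<dots> = (\<Sum>k=0..m. \<Sum>i\<le>m. \<Sum>j\<le>m. F $ i $ k * G $ j $ (m - k))"
    by (rule sum.swap)
  also have "\<dots> = (eval1 F * eval1 G) $ m"
    by (simp add: fps_mult_nth eval1_nth[OF assms(1), where N = m] eval1_nth[OF assms(2), where N = m]
        sum_product)
  finally show "eval1 (F * G) $ m = (eval1 F * eval1 G) $ m" .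
qed

lemma fps_power_nth_low:
  assumes "(Y::'a::semiring_1 fps) $ 0 = 0" "m < n"
  shows "(Y ^ n) $ m = 0"
  using assms(2)
proof (induction n arbitrary: m)
  case (Suc n)
  show ?case unfolding power_Suc
    by (rule fps_mult_nth_low[where a = 1 and b = n]) (use Suc assms in auto)
qed simp

lemma evaluable_expser: "Y $ 0 = 0 \<Longrightarrow> evaluable (expser Y)"
  by (simp add: evaluable_def divpow_def fps_power_nth_low)

lemma fps_expQ_eq_eval1: "fps_expQ Y = eval1 (expser Y)"
  by (simp add: fps_expQ_def eval1_def divpow_def)

lemma fps_expQ_nth:
  "Y $ 0 = 0 \<Longrightarrow> m \<le> N \<Longrightarrow> fps_expQ Y $ m = (\<Sum>k\<le>N. (1 / fact k) *\<^sub>Q ((Y ^ k) $ m))"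
  by (simp add: fps_expQ_eq_eval1 eval1_nth[OF evaluable_expser] divpow_def)

lemma fps_expQ_nth_0 [simp]: "fps_expQ Y $ 0 = 1"
  by (simp add: fps_expQ_def)

lemma fps_expQ_0 [simp]: "fps_expQ 0 = 1"
  by (rule fps_ext) (simp add: fps_expQ_def power_0_left if_distrib[of "\<lambda>F. F $ _"] cong: if_cong)

lemma fps_expQ_add:
  assumes "X * Y = Y * X" "X $ 0 = 0" "Y $ 0 = 0"
  shows "fps_expQ (X + Y) = fps_expQ X * fps_expQ Y"
  by (simp add: fps_expQ_eq_eval1 expser_add assms eval1_mult evaluable_expser)

lemma mult_fps_expQ:
  fixes A :: "nat \<Rightarrow> 'a::rat_algebra_1 fps"
  assumes Y: "Y $ 0 = 0" and A: "\<And>k. A k * Y - Y * A k = A (Suc k)"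
    and low: "\<And>k i. i < k \<Longrightarrow> A k $ i = 0"
  shows "A 0 * fps_expQ Y = fps_expQ Y * Abs_fps (\<lambda>n. \<Sum>k\<le>n. (1 / fact k) *\<^sub>Q (A k $ n))"
proof -
  let ?A = "Abs_fps (\<lambda>k. (1 / fact k) *\<^sub>Q A k)"
  have "evaluable ?A" using low by (simp add: evaluable_def)
  moreover have "fps_const (A 0) * expser Y = expser Y * ?A"
    by (rule mult_expser) (rule A)
  ultimately have "eval1 (fps_const (A 0)) * eval1 (expser Y) = eval1 (expser Y) * eval1 ?A"
    by (metis eval1_mult evaluable_const evaluable_expser[OF Y])
  moreover have "eval1 ?A = Abs_fps (\<lambda>n. \<Sum>k\<le>n. (1 / fact k) *\<^sub>Q (A k $ n))"
    by (simp add: eval1_def)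
  ultimately show ?thesis by (simp add: fps_expQ_eq_eval1)
qed

text \<open>Repeated bracketing of \<open>x^-\<close> with \<open>x^+\<close> yields
  \<open>h\<close>, \<open>x^+\<close>, \<open>X^+\<close> and then 0. So three brackets suffice,
  and the adjoint exponential is a cubic with the coefficients 1/2! and 1/3!.\<close>

lemma fps_expQ_mult3:
  fixes A :: "'a::rat_algebra_1 fps"
  assumes Y: "Y $ 0 = 0" and A: "Y * A - A * Y = A1" "Y * A1 - A1 * Y = A2"
    "Y * A2 - A2 * Y = A3" "Y * A3 = A3 * Y"
  shows "fps_expQ Y * A = (A + A1 + (1/2) *\<^sub>Q A2 + (1/6) *\<^sub>Q A3) * fps_expQ Y"
proof -
  have E: "fps_expQ Y * fps_expQ (- Y) = 1" "fps_expQ (- Y) * fps_expQ Y = 1"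
    using fps_expQ_add[of Y "- Y"] fps_expQ_add[of "- Y" Y] Y by simp_all
  define B where "B k = (if k = 0 then A else if k = 1 then A1 else if k = 2 then A2
    else if k = 3 then A3 else 0)" for k :: nat
  have B: "B k * (- Y) - (- Y) * B k = B (Suc k)" for k
    using A by (auto simp: B_def)
  have low: "B k $ i = 0" if "i < k" for k i
    using that
  proof (induction k arbitrary: i)
    case (Suc k)
    have "(Y * B k) $ i = 0" "(B k * Y) $ i = 0"
      by (rule fps_mult_nth_low[where a = 1 and b = k]; use Suc Y in simp)
         (rule fps_mult_nth_low[where a = k and b = 1]; use Suc Y in simp)
    then show ?case by (simp flip: B)
  qed simp
  let ?A = "A + A1 + (1/2) *\<^sub>Q A2 + (1/6) *\<^sub>Q A3"
  have sums: "(\<Sum>k\<le>n. (1 / fact k) *\<^sub>Q (B k $ n)) = ?A $ n" for n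
  proof -
    have "(\<Sum>k\<le>n. (1 / fact k) *\<^sub>Q (B k $ n)) = (\<Sum>k\<le>n+3. (1 / fact k) *\<^sub>Q (B k $ n))"
      by (rule sum.mono_neutral_left) (use low in auto)
    also have "\<dots> = (\<Sum>k\<le>3. (1 / fact k) *\<^sub>Q (B k $ n))"
      by (rule sum.mono_neutral_right) (auto simp: B_def)
    also have "\<dots> = ?A $ n" by (simp add: B_def numeral_3_eq_3 fact_Suc)
    finally show ?thesis .
  qed
  \<comment> \<open>\<open>mult_fps_expQ\<close> moves a factor from the left of an exponential to
    its right; the opposite direction is obtained from \<open>- Y\<close> by multiplying with
    \<open>fps_expQ Y\<close> on both sides.\<close>
  have "A * fps_expQ (- Y) = fps_expQ (- Y) * ?A"
    using mult_fps_expQ[of "- Y" B, OF _ B low] Y by (simp only: sums fps_nth_inverse) (simp add: B_def)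
  then have "fps_expQ Y * (A * fps_expQ (- Y)) * fps_expQ Y = fps_expQ Y * (fps_expQ (- Y) * ?A) * fps_expQ Y"
    by simp
  then show ?thesis by (metis (no_types, lifting) E mult.assoc mult_1_left mult_1_right)
qed

text \<open>Covers coefficientwise derivations (\<open>j = 0\<close>) and \<open>fps_deriv\<close> (\<open>j = 1\<close>).\<close>

lemma derivation_fps_expQ:
  fixes Y :: "'a::rat_algebra_1 fps"
  assumes nth: "\<And>F m. D F $ m = \<delta> m (F $ (m + j))"
    and add: "\<And>m x y. \<delta> m (x + y) = \<delta> m x + \<delta> m y"
    and Leibniz: "\<And>F G. D (F * G) = F * D G + D F * G"
    and Y: "Y $ 0 = 0" and comm: "Y * D Y = D Y * Y"
  shows "D (fps_expQ Y) = fps_expQ Y * D Y"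
proof -
  have \<delta>0: "\<delta> m 0 = 0" for m using add[of m 0 0] by simp
  have \<delta>neg: "\<delta> m (- x) = - \<delta> m x" for m x
    using add[of m x "- x"] by (simp add: \<delta>0 minus_unique)
  have \<delta>nat: "\<delta> m (of_nat n * x) = of_nat n * \<delta> m x" for m n x
    by (induction n) (simp_all add: \<delta>0 add algebra_simps)
  \<comment> \<open>\<delta> is only additive, but division by positive integers is unique, so it
    commutes with the scalars \<open>1 / (n+1)\<close>.\<close>
  have \<delta>Q: "\<delta> m ((1 / of_nat (Suc n)) *\<^sub>Q x) = (1 / of_nat (Suc n)) *\<^sub>Q \<delta> m x" for m n x
  proof -
    have "of_nat (Suc n) *\<^sub>Q \<delta> m ((1 / of_nat (Suc n)) *\<^sub>Q x) = \<delta> m (of_nat (Suc n) *\<^sub>Q (1 / of_nat (Suc n)) *\<^sub>Q x)"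
      by (simp only: scaleQ_of_nat \<delta>nat)
    then have "of_nat (Suc n) *\<^sub>Q \<delta> m ((1 / of_nat (Suc n)) *\<^sub>Q x) = \<delta> m x"
      by (simp del: of_nat_Suc)
    from arg_cong[OF this, of "scaleQ (1 / of_nat (Suc n))"] show ?thesis
      by (simp del: of_nat_Suc)
  qed
  have DQ: "D ((1 / of_nat (Suc n)) *\<^sub>Q F) = (1 / of_nat (Suc n)) *\<^sub>Q D F" for n F
    by (rule fps_ext) (simp add: nth \<delta>Q del: of_nat_Suc)
  have D1: "D 1 = 0" using Leibniz[of 1 1] by simp
  have Ddiv: "D (divpow Y (Suc n)) = divpow Y n * D Y" for n
  proof (induction n)
    case 0
    have "divpow Y (Suc 0) = Y" by (simp add: divpow_def)
    then show ?case by simp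
  next
    case (Suc n)
    have eq: "divpow Y (Suc k) = (1 / of_nat (Suc k)) *\<^sub>Q (divpow Y k * Y)" for k
      using divpow_Suc[of k Y] by (simp del: of_nat_Suc flip: divpow_Suc)
    have "D (divpow Y (Suc (Suc n))) = (1 / of_nat (Suc (Suc n))) *\<^sub>Q
        (divpow Y (Suc n) * D Y + divpow Y n * D Y * Y)"
      by (subst eq) (simp add: DQ Leibniz Suc.IH del: of_nat_Suc)
    also have "divpow Y n * D Y * Y = of_nat (Suc n) *\<^sub>Q (divpow Y (Suc n) * D Y)"
      using comm by (simp add: mult.assoc mult_scaleQ_left[symmetric] divpow_Suc del: of_nat_Suc mult_scaleQ)
    also have "divpow Y (Suc n) * D Y + of_nat (Suc n) *\<^sub>Q (divpow Y (Suc n) * D Y)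
        = of_nat (Suc (Suc n)) *\<^sub>Q (divpow Y (Suc n) * D Y)"
      by (metis of_nat_Suc scaleQ_add_left scaleQ_one)
    finally show ?case by (simp del: of_nat_Suc)
  qed
  let ?E = "expser Y * fps_const (D Y)"
  have ev: "evaluable ?E" by (intro evaluable_mult evaluable_expser Y evaluable_const)
  have \<delta>sum: "\<delta> m (\<Sum>k\<in>A. f k) = (\<Sum>k\<in>A. \<delta> m (f k))" for m and A :: "nat set" and f
    by (induction A rule: infinite_finite_induct) (simp_all add: \<delta>0 add)
  show ?thesis
  proof (rule fps_ext)
    fix m
    \<comment> \<open>The bound is one larger than the degree requires: splitting off the term
      \<open>k = 0\<close>, where \<open>D 1 = 0\<close>, then leaves exactly the terms up to
      \<open>m + j\<close>.\<close>
    have "D (fps_expQ Y) $ m = \<delta> m (\<Sum>k\<le>Suc (m + j). (expser Y) $ k $ (m + j))"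
      unfolding nth fps_expQ_eq_eval1
      by (subst eval1_nth[where N = "Suc (m + j)"]) (simp_all add: evaluable_expser Y)
    also have "\<dots> = (\<Sum>k\<le>Suc (m + j). D (divpow Y k) $ m)"
      by (simp add: \<delta>sum nth del: sum.atMost_Suc)
    also have "\<dots> = (\<Sum>k\<le>m + j. ?E $ k $ m)"
      by (simp add: sum.atMost_Suc_shift Ddiv D1 del: sum.atMost_Suc)
    also have "\<dots> = eval1 ?E $ m" by (rule eval1_nth[symmetric]) (simp_all add: ev)
    finally show "D (fps_expQ Y) $ m = (fps_expQ Y * D Y) $ m"
      by (simp add: eval1_mult evaluable_expser Y fps_expQ_eq_eval1)
  qed
qed

lemma fps_deriv_fps_expQ:
  fixes Y :: "'a::rat_algebra_1 fps"
  assumes "Y $ 0 = 0" "Y * fps_deriv Y = fps_deriv Y * Y"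
  shows "fps_deriv (fps_expQ Y) = fps_expQ Y * fps_deriv Y"
  by (rule derivation_fps_expQ[where j = 1 and \<delta> = "\<lambda>m x. of_nat (m + 1) * x"])
    (simp_all add: assms distrib_left)

lemma fps_power_nth_cong:
  fixes F G :: "'a::semiring_1 fps"
  assumes "\<And>i. i \<le> n \<Longrightarrow> F $ i = G $ i" "m \<le> n"
  shows "(F ^ k) $ m = (G ^ k) $ m"
  using assms(2)
proof (induction k arbitrary: m)
  case (Suc k)
  then show ?case using assms(1) by (auto simp: fps_mult_nth intro!: sum.cong)
qed simp

lemma fps_expQ_nth_cong:
  assumes "\<And>i. i \<le> n \<Longrightarrow> F $ i = G $ i"
  shows "fps_expQ F $ n = fps_expQ G $ n"
  unfolding fps_expQ_def using fps_power_nth_cong[of n F G n] assms by simp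

lemma fps_expQ_prod:
  fixes Y :: "nat \<Rightarrow> 'a::rat_algebra_1 fps"
  assumes "\<And>i. Y i $ 0 = 0" "\<And>i j. Y i * Y j = Y j * Y i"
  shows "fps_expQ (\<Sum>i<n. Y i) = prod_list (map (\<lambda>i. fps_expQ (Y i)) [0..<n])"
proof (induction n)
  case (Suc n)
  have "(\<Sum>i<n. Y i) * Y n = Y n * (\<Sum>i<n. Y i)"
    by (simp add: sum_distrib_left sum_distrib_right assms(2))
  then show ?case
    using Suc by (simp add: fps_expQ_add assms(1) fps_sum_nth)
qed simp

text \<open>The common form of all substitutions below: the variable becomes its k-th power and the
  coefficient of degree \<open>n\<close> passes through \<open>\<theta> n\<close>. Instances are
  \<open>u -> -u\<close>, \<open>u -> u^4\<close>, \<open>u -> c u^k\<close>,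
  \<open>w -> z^2\<close>, \<open>w -> p z^2\<close> and the specialization
  \<open>p = 0\<close>.\<close>

definition fps_graded :: "nat \<Rightarrow> (nat \<Rightarrow> 'a \<Rightarrow> 'b::zero) \<Rightarrow> 'a fps \<Rightarrow> 'b fps" where
  "fps_graded k \<theta> F = Abs_fps (\<lambda>n. if k dvd n then \<theta> (n div k) (F $ (n div k)) else 0)"

locale graded_hom =
  fixes k :: nat and \<theta> :: "nat \<Rightarrow> 'a::rat_algebra_1 \<Rightarrow> 'b::rat_algebra_1"
  assumes k: "k > 0"
    and add: "\<theta> n (x + y) = \<theta> n x + \<theta> n y"
    and mult: "\<theta> (m + n) (x * y) = \<theta> m x * \<theta> n y"
    and one: "\<theta> 0 1 = 1"
    and scaleQ: "\<theta> n (q *\<^sub>Q x) = q *\<^sub>Q \<theta> n x"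
begin

lemma zero: "\<theta> n 0 = 0"
  using add[of n 0 0] by simp

lemma sum: "\<theta> n (\<Sum>i\<in>A. f i) = (\<Sum>i\<in>A. \<theta> n (f i))"
  by (induction A rule: infinite_finite_induct) (simp_all add: add zero)

lemma graded_mult: "fps_graded k \<theta> (F * G) = fps_graded k \<theta> F * fps_graded k \<theta> G"
proof (rule fps_ext)
  fix n
  let ?f = "\<lambda>i. fps_graded k \<theta> F $ i * fps_graded k \<theta> G $ (n - i)"
  show "fps_graded k \<theta> (F * G) $ n = (fps_graded k \<theta> F * fps_graded k \<theta> G) $ n"
  proof (cases "k dvd n")
    case False
    then have "?f i = 0" if "i \<le> n" for i
      using that dvd_add[of k i "n - i"] by (auto simp: fps_graded_def)
    then show ?thesis using False by (simp add: fps_mult_nth fps_graded_def)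
  next
    case True
    then obtain m where n: "n = k * m" by auto
    have "(\<Sum>i=0..n. ?f i) = (\<Sum>i\<in>(*) k ` {0..m}. ?f i)"
    proof (rule sum.mono_neutral_right)
      show "\<forall>i\<in>{0..n} - (*) k ` {0..m}. ?f i = 0"
        using n k by (auto simp: fps_graded_def elim!: dvdE)
    qed (use n in auto)
    also have "\<dots> = (\<Sum>i=0..m. \<theta> i (F $ i) * \<theta> (m - i) (G $ (m - i)))"
      using k by (subst sum.reindex) (auto simp: inj_on_def fps_graded_def n right_diff_distrib'[symmetric])
    also have "\<dots> = \<theta> m ((F * G) $ m)"
      by (auto simp: fps_mult_nth sum mult[symmetric] intro!: sum.cong)
    finally show ?thesis using n k by (simp add: fps_mult_nth fps_graded_def)
  qed
qed

lemma graded_one: "fps_graded k \<theta> 1 = 1"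
  using k by (auto simp: fps_eq_iff fps_graded_def one zero elim!: dvdE)

lemma graded_power: "fps_graded k \<theta> (F ^ n) = fps_graded k \<theta> F ^ n"
  by (induction n) (simp_all add: graded_one graded_mult)

lemma graded_expQ:
  assumes "F $ 0 = 0"
  shows "fps_graded k \<theta> (fps_expQ F) = fps_expQ (fps_graded k \<theta> F)"
proof (rule fps_ext)
  fix n
  have 0: "fps_graded k \<theta> F $ 0 = 0" using assms by (simp add: fps_graded_def zero)
  show "fps_graded k \<theta> (fps_expQ F) $ n = fps_expQ (fps_graded k \<theta> F) $ n"
    by (subst fps_expQ_nth[OF 0 order_refl])
      (simp add: fps_graded_def[of _ _ "fps_expQ F"] fps_expQ_nth[OF assms, of _ n] sum scaleQ
        graded_power[symmetric], simp add: fps_graded_def)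
qed

end

section \<open>Integral power series\<close>

definition zsubring :: "'a::ring_1 set \<Rightarrow> bool" where
  "zsubring S \<longleftrightarrow> 1 \<in> S \<and> (\<forall>a\<in>S. \<forall>b\<in>S. a - b \<in> S \<and> a * b \<in> S)"

lemma zsubring_zsubalg: "zsubring (zsubalg S)"
  by (simp add: zsubring_def zsubalg.intros)

lemma zsubring_Ints: "zsubring (\<int> :: 'a::ring_1 set)"
  by (simp add: zsubring_def)

context
  fixes S :: "'a::ring_1 set"
  assumes S: "zsubring S"
begin

lemma zsubring_one: "1 \<in> S"
  and zsubring_diff: "a \<in> S \<Longrightarrow> b \<in> S \<Longrightarrow> a - b \<in> S"
  and zsubring_mult: "a \<in> S \<Longrightarrow> b \<in> S \<Longrightarrow> a * b \<in> S"
  using S by (simp_all add: zsubring_def)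

lemma zsubring_zero: "0 \<in> S"
  using zsubring_diff[OF zsubring_one zsubring_one] by simp

lemma zsubring_uminus: "a \<in> S \<Longrightarrow> - a \<in> S"
  using zsubring_diff[OF zsubring_zero] by simp

lemma zsubring_add: "a \<in> S \<Longrightarrow> b \<in> S \<Longrightarrow> a + b \<in> S"
  using zsubring_diff[OF _ zsubring_uminus] by simp

lemma zsubring_power: "a \<in> S \<Longrightarrow> a ^ n \<in> S"
  by (induction n) (simp_all add: zsubring_one zsubring_mult)

lemma zsubring_sum: "(\<And>i. i \<in> A \<Longrightarrow> f i \<in> S) \<Longrightarrow> sum f A \<in> S"
  by (induction A rule: infinite_finite_induct) (simp_all add: zsubring_zero zsubring_add)

lemma zsubring_prod_list: "(\<And>x. x \<in> set xs \<Longrightarrow> x \<in> S) \<Longrightarrow> prod_list xs \<in> S"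
  by (induction xs) (simp_all add: zsubring_one zsubring_mult)

lemma zsubring_of_nat: "of_nat n \<in> S"
  by (induction n) (simp_all add: zsubring_zero zsubring_one zsubring_add)

lemma zsubring_of_int: "of_int n \<in> S"
  by (cases n rule: int_cases2) (simp_all add: zsubring_of_nat zsubring_uminus)

end

lemma zsubring_scaleQ_Ints:
  assumes "zsubring S" "q \<in> \<int>" "x \<in> S"
  shows "q *\<^sub>Q x \<in> (S :: 'a::rat_algebra_1 set)"
  using assms by (auto simp: scaleQ_of_int zsubring_mult zsubring_of_int elim!: Ints_cases)

definition fps_over :: "'a set \<Rightarrow> 'a fps set" where
  "fps_over S = {F. \<forall>n. F $ n \<in> S}"

lemma zsubring_fps_over:
  assumes "zsubring S"
  shows "zsubring (fps_over S)"
  using assms unfolding zsubring_def[of "fps_over S"]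
  by (auto simp: fps_over_def fps_mult_nth zsubring_zero zsubring_one
      intro!: zsubring_sum zsubring_mult zsubring_diff)

lemma fps_X_in_fps_over: "zsubring S \<Longrightarrow> fps_X \<in> fps_over S"
  by (auto simp: fps_over_def zsubring_zero zsubring_one fps_X_def)

lemma fps_numeral_in_fps_over: "zsubring S \<Longrightarrow> numeral n \<in> fps_over S"
  using zsubring_of_nat[OF zsubring_fps_over, of S "numeral n"] by simp

lemma fps_over_cancel:
  assumes S: "zsubring S" and F: "F \<in> fps_over S" "F $ 0 = 1" and FG: "F * G \<in> fps_over S"
  shows "G \<in> fps_over S"
proof -
  have "G $ n \<in> S" for n
  proof (induction n rule: less_induct)
    case (less n)
    have "G $ n = (F * G) $ n - (\<Sum>i\<in>{1..n}. F $ i * G $ (n - i))"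
      by (simp add: fps_mult_nth sum.atLeast_Suc_atMost F)
    moreover have "F $ i * G $ (n - i) \<in> S" if "i \<in> {1..n}" for i
      using that F(1) less by (intro zsubring_mult[OF S]) (auto simp: fps_over_def)
    ultimately show ?case
      using FG by (auto simp: fps_over_def intro!: zsubring_diff[OF S] zsubring_sum[OF S])
  qed
  then show ?thesis by (simp add: fps_over_def)
qed

text \<open>Writing \<open>F = 1 + 2cK\<close> turns the hypothesis into
  \<open>K + c K^2 = G\<close>; the 4 is what makes the linear coefficient 1. As \<open>K\<close>
  has no constant term, degree \<open>n\<close> of \<open>K^2\<close> involves only smaller degrees
  of \<open>K\<close>, and integrality follows recursively.\<close>

lemma fps_sqrt_integral:
  fixes F G :: "rat fps" and c :: int
  assumes F0: "F $ 0 = 1" and sq: "F ^ 2 = 1 + of_int (4 * c) * G" and G: "G \<in> fps_over \<int>"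
  obtains K where "K \<in> fps_over \<int>" "F = 1 + of_int (2 * c) * K"
proof (cases "c = 0")
  case True
  then have "(F - 1) * (F + 1) = 0" using sq by (simp add: algebra_simps power2_eq_square)
  moreover have "(F + 1) $ 0 \<noteq> 0" using F0 by simp
  then have "F + 1 \<noteq> 0" by force
  ultimately have "F = 1 + of_int (2 * c) * 0" by simp
  then show ?thesis by (rule that[rotated]) (simp add: fps_over_def)
next
  case False
  define K where "K = fps_const (1 / (2 * of_int c)) * (F - 1)"
  have "of_int (2 * c) * fps_const (1 / (2 * of_int c)) = (1 :: rat fps)"
    using False by (simp add: fps_of_int[symmetric] del: of_int_mult)
  then have F: "F = 1 + of_int (2 * c) * K"
    by (simp add: K_def mult.assoc[symmetric] del: of_int_mult)
  have "of_int (4 * c) * (K + of_int c * K ^ 2) = of_int (4 * c) * G"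
    using sq unfolding F by (simp add: algebra_simps power2_eq_square)
  moreover have "of_int (4 * c) \<noteq> (0 :: rat fps)"
  proof -
    have "(of_int (4 * c) :: rat fps) $ 0 \<noteq> 0"
      using False by (simp add: fps_of_int[symmetric] del: of_int_mult)
    then show ?thesis by (metis fps_zero_nth)
  qed
  ultimately have G': "K = G - of_int c * K ^ 2"
    by (metis add_diff_cancel_right' mult_left_cancel)
  have K0: "K $ 0 = 0" using F0 by (simp add: K_def)
  have "K $ n \<in> \<int>" for n
  proof (induction n rule: less_induct)
    case (less n)
    have "K $ i * K $ (n - i) \<in> \<int>" if "i \<le> n" for i
      using that less[of i] less[of "n - i"] K0 by (cases "i = 0 \<or> i = n") auto
    then have "(K ^ 2) $ n \<in> \<int>"
      by (auto simp: power2_eq_square fps_mult_nth intro!: Ints_sum)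
    moreover have "K $ n = G $ n - of_int c * (K ^ 2) $ n"
      by (subst G') (simp add: fps_of_int[symmetric])
    ultimately show ?case using G by (auto simp: fps_over_def)
  qed
  then have "K \<in> fps_over \<int>" by (simp add: fps_over_def)
  then show ?thesis using that F by blast
qed

section \<open>Half companion Pell numbers and their exponential series\<close>

fun pell :: "nat \<Rightarrow> int" where
  "pell 0 = 1"
| "pell (Suc 0) = 1"
| "pell (Suc (Suc n)) = 2 * pell (Suc n) + pell n"

lemma pell_closed_form: "2 * real_of_int (pell n) = (1 + sqrt 2) ^ n + (1 - sqrt 2) ^ n"
proof (induction n rule: pell.induct)
  case (3 n)
  have "(1 + sqrt 2) ^ 2 = 2 * (1 + sqrt 2) + 1" "(1 - sqrt 2) ^ 2 = 2 * (1 - sqrt 2) + 1"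
    by (simp_all add: power2_eq_square algebra_simps)
  then have "(1 + sqrt 2) ^ Suc (Suc n) = 2 * (1 + sqrt 2) ^ Suc n + (1 + sqrt 2) ^ n"
    "(1 - sqrt 2) ^ Suc (Suc n) = 2 * (1 - sqrt 2) ^ Suc n + (1 - sqrt 2) ^ n"
    by (simp_all add: power2_eq_square mult.assoc[symmetric] del: mult.assoc) (simp_all add: algebra_simps)
  moreover have "2 * real_of_int (pell (Suc (Suc n))) = 2 * (2 * pell (Suc n)) + 2 * pell n"
    by simp
  ultimately show ?case using 3 by linarith
qed simp_all

text \<open>The numbers \<open>1 + sqrt 2\<close> and \<open>1 - sqrt 2\<close> have product -1. The
  identity is the two-term recurrence of the sequence along arithmetic progressions of step
  \<open>k\<close>, which produces the denominator \<open>pell_poly k\<close>.\<close>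

lemma pell_add_double: "pell (m + 2 * k) = 2 * pell k * pell (m + k) - (-1) ^ k * pell m"
proof -
  define \<alpha> \<beta> where "\<alpha> = 1 + sqrt 2" and "\<beta> = 1 - sqrt 2"
  have ab: "\<alpha> ^ k * \<beta> ^ k = (-1) ^ k"
    by (simp add: \<alpha>_def \<beta>_def algebra_simps flip: power_mult_distrib)
  have pell: "real_of_int (pell n) = (\<alpha> ^ n + \<beta> ^ n) / 2" for n
    using pell_closed_form[of n] by (simp add: \<alpha>_def \<beta>_def)
  have "real_of_int (pell (m + 2 * k)) = 2 * pell k * pell (m + k) - (\<alpha> ^ k * \<beta> ^ k) * pell m"
    unfolding of_int_mult of_int_add pell power_add mult_2 of_int_numeral
    by (simp add: algebra_simps add_divide_distrib)
  then have "real_of_int (pell (m + 2 * k)) = real_of_int (2 * pell k * pell (m + k) - (-1) ^ k * pell m)"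
    unfolding ab by simp
  then show ?thesis by (simp only: of_int_eq_iff)
qed

lemma odd_pell: "odd (pell n)"
  by (induction n rule: pell.induct) auto

text \<open>Modulo 4 the sequence runs through 1, 1, 3, 3 periodically. Both residues are needed to
  continue the induction by four steps of the recurrence, which give the coefficients 5, 12 and
  29.\<close>

lemma pell_mod_4: "(\<exists>c. pell (4 * n) = 1 + 4 * c) \<and> (\<exists>c. pell (4 * n + 1) = 1 + 4 * c)"
proof (induction n)
  case (Suc n)
  have "pell (4 * Suc n) = 12 * pell (4 * n + 1) + 5 * pell (4 * n)"
    "pell (4 * Suc n + 1) = 29 * pell (4 * n + 1) + 12 * pell (4 * n)"
    by (simp_all add: eval_nat_numeral)
  moreover obtain a b where "pell (4 * n) = 1 + 4 * a" "pell (4 * n + 1) = 1 + 4 * b"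
    using Suc by blast
  ultimately have "pell (4 * Suc n) = 1 + 4 * (4 + 12 * b + 5 * a)"
    "pell (4 * Suc n + 1) = 1 + 4 * (10 + 29 * b + 12 * a)"
    by simp_all
  then show ?case by blast
qed (auto intro: exI[of _ 0])

lemma half_log_series_deriv:
  "fps_deriv half_log_series * (1 + 2 * fps_X - fps_X ^ 2) = 1 - fps_X"
proof -
  let ?g = "2 * fps_X - fps_X ^ 2 :: rat fps"
  have g0: "?g $ 0 = 0" by simp
  have "inverse (1 + fps_X) * (1 + fps_X) = (1 :: rat fps)"
    by (rule inverse_mult_eq_1) simp
  from arg_cong[OF this, of "\<lambda>F. F oo ?g"]
  have "(inverse (1 + fps_X) oo ?g) * (1 + ?g) = 1"
    by (simp add: fps_compose_mult_distrib[OF g0] fps_compose_add_distrib)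
  then have "(inverse (1 + fps_X) oo ?g) * (1 + 2 * fps_X - fps_X ^ 2) * (fps_const (1/2) * fps_deriv ?g)
      = fps_const (1/2) * fps_deriv ?g"
    by (simp add: add_diff_eq)
  moreover have "fps_deriv half_log_series = fps_const (1/2) * ((inverse (1 + fps_X) oo ?g) * fps_deriv ?g)"
    by (simp add: half_log_series_def fps_compose_deriv[OF g0] fps_ln_deriv)
  moreover have "fps_const (1/2) * fps_deriv ?g = 1 - fps_X"
    by (simp add: fps_eq_iff power2_eq_square numeral_fps_const)
  ultimately show ?thesis by (simp only: mult_ac)
qed

lemma d_seq_eq_pell: "d_seq (Suc n) = of_int (pell (Suc n))"
proof -
  define c where "c n = fps_deriv half_log_series $ n" for n
  have eq: "fps_deriv half_log_series + 2 * (fps_X * fps_deriv half_log_series)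
      - fps_X * (fps_X * fps_deriv half_log_series) = 1 - fps_X"
    using half_log_series_deriv by (simp add: algebra_simps power2_eq_square)
  have rec: "c n + 2 * (if n = 0 then 0 else c (n - 1)) - (if n < 2 then 0 else c (n - 2))
      = (if n = 0 then 1 else 0) - (if n = 1 then 1 else 0)" for n
    using arg_cong[OF eq, of "\<lambda>F. F $ n"]
    by (cases n; cases "n - 1") (simp_all add: c_def numeral_fps_const del: fps_deriv_nth)
  have "(-1) ^ n * c n = of_int (pell (Suc n))"
  proof (induction n rule: pell.induct)
    case 1
    then show ?case using rec[of 0] by simp
  next
    case 2
    then show ?case using rec[of 0] rec[of 1] by simp
  next
    case (3 n)
    have "c (Suc (Suc n)) = c n - 2 * c (Suc n)"
      using rec[of "Suc (Suc n)"] by simp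
    then have "(-1) ^ Suc (Suc n) * c (Suc (Suc n)) = 2 * ((-1) ^ Suc n * c (Suc n)) + (-1) ^ n * c n"
      by (simp add: right_diff_distrib)
    then show ?case using 3 by simp
  qed
  moreover have "d_seq (Suc n) = (-1) ^ n * c n"
    by (simp add: d_seq_def c_def)
  ultimately show ?thesis by simp
qed

definition pell_log :: "nat \<Rightarrow> rat fps" where
  "pell_log k = Abs_fps (\<lambda>s. if s = 0 then 0 else of_int (pell (k * s)) / of_nat s)"

definition pell_exp :: "nat \<Rightarrow> rat fps" where
  "pell_exp k = fps_expQ (pell_log k)"

text \<open>With \<alpha> and \<beta> equal to \<open>1 + sqrt 2\<close> and
  \<open>1 - sqrt 2\<close> this is \<open>(1 - \<alpha>^k u) (1 - \<beta>^k u)\<close>, and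
  \<open>pell_log k\<close> is -1/2 times its logarithm.\<close>

definition pell_poly :: "nat \<Rightarrow> rat fps" where
  "pell_poly k = 1 - 2 * of_int (pell k) * fps_X + (-1) ^ k * fps_X ^ 2"

lemma pell_log_0 [simp]: "pell_log k $ 0 = 0"
  by (simp add: pell_log_def)

lemma pell_exp_0 [simp]: "pell_exp k $ 0 = 1"
  by (simp add: pell_exp_def)

lemma fps_const_minus_one_power: "fps_const ((-1) ^ k) = ((-1) ^ k :: rat fps)"
  by (cases "even k") (simp_all add: fps_eq_iff)

lemma fps_const_twice_of_int: "fps_const (2 * of_int c) = (2 * of_int c :: rat fps)"
  by (simp add: fps_of_int[symmetric] numeral_fps_const)

lemma pell_log_deriv: "fps_deriv (pell_log k) * pell_poly k = of_int (pell k) - (-1) ^ k * fps_X"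
proof -
  define D where "D = fps_deriv (pell_log k)"
  have expand: "D * (1 - 2 * d * x + e * x ^ 2) = D - 2 * d * (x * D) + e * (x * (x * D))" for d e x
    by (simp add: algebra_simps power2_eq_square)
  have D: "D $ n = of_int (pell (k * Suc n))" for n
    by (simp add: D_def pell_log_def del: of_nat_Suc)
  have "D - fps_const (2 * of_int (pell k)) * (fps_X * D) + fps_const ((-1) ^ k) * (fps_X * (fps_X * D))
      = fps_const (of_int (pell k)) - fps_const ((-1) ^ k) * fps_X" (is "?l = ?r")
  proof (rule fps_ext)
    fix n
    consider "n = 0" | "n = 1" | m where "n = Suc (Suc m)"
      by (metis One_nat_def not0_implies_Suc)
    then show "?l $ n = ?r $ n"
    proof cases
      case 2
      have "k * Suc 1 = 0 + 2 * k" by simp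
      then have "D $ 1 = of_int (2 * pell k * pell (0 + k) - (-1) ^ k * pell 0)"
        by (simp only: D pell_add_double)
      then show ?thesis using 2 D[of 0] by simp
    next
      case (3 m)
      have "pell (k * Suc (Suc (Suc m))) = 2 * pell k * pell (k * Suc (Suc m)) - (-1) ^ k * pell (k * Suc m)"
        using pell_add_double[of "k * Suc m" k] by (metis add.assoc add.commute mult_2 mult_Suc_right)
      then show ?thesis using 3 by (simp only: fps_add_nth fps_sub_nth fps_mult_left_const_nth fps_X_mult_nth D) simp
    qed (simp add: D)
  qed
  then show ?thesis
    unfolding fps_const_minus_one_power fps_const_twice_of_int fps_of_int
    by (simp only: pell_poly_def expand D_def[symmetric])
qed

lemma pell_exp_square: "pell_exp k ^ 2 * pell_poly k = 1"
proof -
  let ?V = "pell_exp k" and ?L = "fps_deriv (pell_log k)"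
  have V: "fps_deriv ?V = ?V * ?L"
    unfolding pell_exp_def by (rule fps_deriv_fps_expQ) (simp_all add: mult.commute)
  have P: "fps_deriv (pell_poly k) = - 2 * (of_int (pell k) - (-1) ^ k * fps_X)"
    by (simp add: pell_poly_def power2_eq_square algebra_simps minus_one_power_iff
        fps_const_minus_one_power[of 1, simplified])
  have "fps_deriv (?V ^ 2 * pell_poly k) = ?V ^ 2 * fps_deriv (pell_poly k) + 2 * (?V ^ 2) * (?L * pell_poly k)"
    by (simp add: V power2_eq_square algebra_simps)
  also have "\<dots> = 0" unfolding P pell_log_deriv by (simp add: algebra_simps)
  finally have "?V ^ 2 * pell_poly k = fps_const ((?V ^ 2 * pell_poly k) $ 0)"
    by (simp only: fps_deriv_eq_0_iff)
  then show ?thesis by (simp add: pell_poly_def fps_power_zeroth)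
qed

lemmas fps_Ints_intros =
  zsubring_one[OF zsubring_fps_over[OF zsubring_Ints]]
  zsubring_add[OF zsubring_fps_over[OF zsubring_Ints]]
  zsubring_diff[OF zsubring_fps_over[OF zsubring_Ints]]
  zsubring_uminus[OF zsubring_fps_over[OF zsubring_Ints]]
  zsubring_mult[OF zsubring_fps_over[OF zsubring_Ints]]
  zsubring_power[OF zsubring_fps_over[OF zsubring_Ints]]
  zsubring_of_int[OF zsubring_fps_over[OF zsubring_Ints]]
  fps_X_in_fps_over[OF zsubring_Ints] fps_numeral_in_fps_over[OF zsubring_Ints]

lemma pell_poly_integral: "pell_poly k \<in> fps_over \<int>"
  unfolding pell_poly_def by (intro fps_Ints_intros)

text \<open>For even \<open>k\<close> the polynomials \<open>(1-u)^2\<close> and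
  \<open>pell_poly k\<close> differ only by \<open>4cu\<close>; dividing by
  \<open>pell_poly k\<close> gives the form required by \<open>fps_sqrt_integral\<close>. The
  explicit factor \<open>2 * c\<close> matters in \<open>witt_exp_odd\<close>, where
  \<open>c\<close> is itself even.\<close>

lemma pell_exp_even:
  assumes "even k" "pell k = 1 + 2 * c"
  obtains K where "K \<in> fps_over \<int>" "pell_exp k * (1 - fps_X) = 1 + of_int (2 * c) * K"
proof (rule fps_sqrt_integral[where c = c and G = "fps_X * pell_exp k ^ 2"])
  have "pell_exp k ^ 2 \<in> fps_over \<int>"
    by (rule fps_over_cancel[where F = "pell_poly k"])
      (simp_all add: zsubring_Ints pell_poly_integral mult.commute[of _ "pell_exp k ^ 2"]
         pell_exp_square zsubring_one zsubring_fps_over, simp add: pell_poly_def)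
  then show "fps_X * pell_exp k ^ 2 \<in> fps_over \<int>"
    by (intro zsubring_mult zsubring_fps_over zsubring_Ints fps_X_in_fps_over)
  have "(1 - fps_X) ^ 2 = pell_poly k + of_int (4 * c) * fps_X"
    using assms by (simp add: pell_poly_def power2_eq_square algebra_simps)
  then have "(pell_exp k * (1 - fps_X)) ^ 2 = pell_exp k ^ 2 * pell_poly k + of_int (4 * c) * (fps_X * pell_exp k ^ 2)"
    by (simp only: power_mult_distrib) (simp add: algebra_simps)
  then show "(pell_exp k * (1 - fps_X)) ^ 2 = 1 + of_int (4 * c) * (fps_X * pell_exp k ^ 2)"
    by (simp add: pell_exp_square)
qed (use that in auto)

lemma pell_exp_integral:
  assumes "even k"
  shows "pell_exp k \<in> fps_over \<int>"
proof -
  obtain c where "pell k = 1 + 2 * c" using odd_pell[of k] by (auto elim!: oddE)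
  then obtain K where "K \<in> fps_over \<int>" "pell_exp k * (1 - fps_X) = 1 + of_int (2 * c) * K"
    using pell_exp_even assms by blast
  then have "(1 - fps_X) * pell_exp k \<in> fps_over \<int>"
    by (simp only: mult.commute[of "1 - fps_X"]) (intro fps_Ints_intros)
  then show ?thesis
    by (rule fps_over_cancel[OF zsubring_Ints, rotated -1]) (intro fps_Ints_intros, simp)
qed

section \<open>Integrality of the one-variable factors\<close>

definition fps_alt :: "rat fps \<Rightarrow> rat fps" where
  "fps_alt = fps_graded (Suc 0) (\<lambda>n x. (-1) ^ n * x)"

interpretation alt: graded_hom "Suc 0" "\<lambda>n (x::rat). (-1) ^ n * x"
  rewrites "fps_graded (Suc 0) (\<lambda>n (x::rat). (-1) ^ n * x) = fps_alt"
  by unfold_locales (simp_all add: algebra_simps power_add fps_alt_def)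

interpretation subst4: graded_hom 4 "\<lambda>_ (x::rat). x"
  by unfold_locales simp_all

lemma fps_alt_nth [simp]: "fps_alt F $ n = (-1) ^ n * F $ n"
  by (simp add: fps_alt_def fps_graded_def)

lemma graded_integral:
  assumes "zsubring S" "F \<in> fps_over S'" "\<And>n x. x \<in> S' \<Longrightarrow> \<theta> n x \<in> S"
  shows "fps_graded k \<theta> F \<in> fps_over S"
  using assms by (auto simp: fps_over_def fps_graded_def zsubring_zero)

text \<open>The logarithm of the factor \<open>g_k\<close>. Passing from \<open>eps\<close> to
  \<open>d_seq\<close> multiplies the n-th coefficient of a logarithm by \<open>d_n / eps_n\<close>,
  which is \<open>d_n * eps_n\<close>; for \<open>1 + c_k u^k\<close> only \<open>n = k * s\<close>
  occurs.\<close>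

definition witt_log :: "nat \<Rightarrow> rat fps" where
  "witt_log k = Abs_fps (\<lambda>s. (-1) ^ (s - 1) * d_seq (k * s) * eps (k * s) / of_nat s)"

lemma witt_log_nth:
  "k > 0 \<Longrightarrow> witt_log k $ s = (-1) ^ (s - 1) * eps (k * s) * pell_log k $ s"
  using d_seq_eq_pell[of "k * s - 1"] by (cases "s = 0") (simp_all add: witt_log_def pell_log_def)

lemma witt_log_0 [simp]: "witt_log k $ 0 = 0"
  by (simp add: witt_log_def)

lemma minus_one_power_pred: "s > 0 \<Longrightarrow> (-1) ^ (s - Suc 0) = - ((-1) ^ s :: 'a::ring_1)"
  by (cases s) auto

lemma four_dvd_mult_odd: "odd k \<Longrightarrow> 4 dvd k * s \<longleftrightarrow> 4 dvd (s::nat)"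
  using coprime_dvd_mult_right_iff[of 4 k s] coprime_power_left_iff[of 2 2 k] by simp

text \<open>For odd \<open>k\<close> the sign \<open>eps (k * s)\<close> is -1 exactly when 4
  divides \<open>s\<close>. Hence the square of \<open>g_k\<close> is \<open>pell_poly k\<close> at
  \<open>-u\<close> times \<open>pell_exp (4 * k)\<close> at \<open>u^4\<close>. Modulo 4, the first
  factor times \<open>(1+u)^2\<close> is \<open>1 - u^4\<close>, and the second times
  \<open>1 - u^4\<close> is 1. So \<open>(g_k * (1+u))^2\<close> is 1 modulo 4 and
  \<open>fps_sqrt_integral\<close> applies.\<close>

lemma witt_exp_odd:
  assumes "odd k"
  shows "fps_expQ (witt_log k) \<in> fps_over \<int>"
proof -
  have k: "k > 0" using assms by (rule odd_pos)
  let ?g = "fps_expQ (witt_log k)"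
  let ?v = "fps_graded 4 (\<lambda>_ x. x) (pell_exp (4 * k))"
  \<comment> \<open>Doubled, because the correction at the multiples of 4 is one half of
    \<open>pell_log (4 * k)\<close> in \<open>u^4\<close>: the flipped sign adds
    \<open>2 * pell (k * s) / s\<close>.\<close>
  have "witt_log k + witt_log k = - fps_alt (pell_log k) + - fps_alt (pell_log k)
      + fps_graded 4 (\<lambda>_ x. x) (pell_log (4 * k))" (is "_ = ?A + ?A + ?B")
  proof (rule fps_ext)
    fix s
    have "witt_log k $ s + witt_log k $ s = ?A $ s + ?A $ s + ?B $ s"
    proof (cases "4 dvd s")
      case True
      then obtain t where s: "s = 4 * t" by auto
      have "pell (k * (4 * t)) = pell (4 * k * t)" by (simp only: mult_ac)
      then show ?thesis using s k assms
        by (auto simp: witt_log_nth eps_def fps_graded_def[of 4] minus_one_power_pred pell_log_def)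
    next
      case False
      then have "s > 0" by (auto intro: Nat.gr0I)
      with False show ?thesis using assms k
        by (simp add: witt_log_nth eps_def four_dvd_mult_odd fps_graded_def[of 4] minus_one_power_pred)
    qed
    then show "(witt_log k + witt_log k) $ s = (?A + ?A + ?B) $ s"
      by (simp only: fps_add_nth)
  qed
  moreover have 0: "?A $ 0 = 0" "(?A + ?A) $ 0 = 0" "?B $ 0 = 0"
    by (simp_all add: fps_graded_def[of 4])
  ultimately have "?g * ?g = fps_expQ ?A * fps_expQ ?A * fps_expQ ?B"
    using fps_expQ_add[OF mult.commute witt_log_0 witt_log_0, of k k]
      fps_expQ_add[OF mult.commute 0(2,3)] fps_expQ_add[OF mult.commute 0(1,1)] by simp
  also have "fps_expQ ?B = ?v"
    by (simp add: pell_exp_def subst4.graded_expQ)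
  also have "fps_expQ ?A * fps_expQ ?A = fps_alt (pell_poly k)"
  proof -
    have 1: "fps_expQ ?A * fps_alt (pell_exp k) = 1"
      by (simp add: pell_exp_def alt.graded_expQ flip: fps_expQ_add)
    have "fps_alt (pell_exp k) ^ 2 * fps_alt (pell_poly k) = 1"
      using arg_cong[OF pell_exp_square[of k], of fps_alt]
      by (simp only: alt.graded_mult alt.graded_power alt.graded_one)
    then have "(fps_expQ ?A * fps_alt (pell_exp k)) ^ 2 * fps_alt (pell_poly k) = fps_expQ ?A ^ 2"
      by (simp add: power_mult_distrib mult.assoc)
    then show ?thesis by (simp add: 1 power2_eq_square)
  qed
  finally have g2: "?g * ?g = fps_alt (pell_poly k) * ?v" .
  obtain j where j: "pell k = 1 + 2 * j" using odd_pell[of k] by (auto elim!: oddE)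
  \<comment> \<open>\<open>J\<close> is a quarter of
    \<open>(1+u)^2 * pell_poly k (-u) - (1 - u^4)\<close>. For \<open>j = 0\<close> that product is
    \<open>(1+2u)^2 - u^4\<close>.\<close>
  define J where "J = (fps_X + fps_X ^ 2 + of_int j * fps_X * (1 + fps_X) ^ 2 :: rat fps)"
  have p: "fps_alt (pell_poly k) = 1 + 2 * of_int (pell k) * fps_X - fps_X ^ 2"
  proof -
    have 1: "pell_poly k = 1 - fps_const (2 * of_int (pell k)) * fps_X - fps_X ^ 2"
      using assms by (simp add: pell_poly_def fps_of_int[symmetric] numeral_fps_const)
    have 2: "1 + 2 * of_int (pell k) * fps_X - fps_X ^ 2
        = (1 + fps_const (2 * of_int (pell k)) * fps_X - fps_X ^ 2 :: rat fps)"
      by (simp add: fps_of_int[symmetric] numeral_fps_const)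
    show ?thesis unfolding 1 2
      by (rule fps_ext) (simp only: fps_alt_nth fps_sub_nth fps_add_nth fps_mult_left_const_nth
          fps_X_nth fps_X_power_nth fps_one_nth split: if_splits, auto)
  qed
  have pJ: "(1 + fps_X) ^ 2 * fps_alt (pell_poly k) = (1 - fps_X ^ 4) + 4 * J"
    unfolding p j J_def by (simp add: algebra_simps power2_eq_square power4_eq_xxxx)
  obtain c where c: "pell (4 * k) = 1 + 2 * (2 * c)"
    using pell_mod_4[of k] by fastforce
  obtain K where K: "K \<in> fps_over \<int>" "pell_exp (4 * k) * (1 - fps_X) = 1 + of_int (2 * (2 * c)) * K"
    using pell_exp_even[OF _ c] by auto
  have X4: "fps_graded 4 (\<lambda>_ x. x) (1 - fps_X) = (1 - fps_X ^ 4 :: rat fps)"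
    by (rule fps_ext) (auto simp: fps_graded_def elim!: dvdE)
  have K4: "fps_graded 4 (\<lambda>_ x. x) (1 + of_int (4 * c) * K) = 1 + of_int (4 * c) * fps_graded 4 (\<lambda>_ x. x) K"
    by (auto simp: fps_eq_iff fps_graded_def fps_of_int[symmetric] simp del: of_int_mult elim!: dvdE)
  have v: "?v * (1 - fps_X ^ 4) = 1 + of_int (4 * c) * fps_graded 4 (\<lambda>_ x. x) K"
    using arg_cong[OF K(2), of "fps_graded 4 (\<lambda>_ x. x)"] K4 by (simp add: subst4.graded_mult X4)
  let ?G = "of_int c * fps_graded 4 (\<lambda>_ x. x) K + J * ?v"
  have "(?g * (1 + fps_X)) ^ 2 = ((1 + fps_X) ^ 2 * fps_alt (pell_poly k)) * ?v"
    using g2 by (simp add: power_mult_distrib power2_eq_square mult.commute mult.left_commute)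
  also have "\<dots> = ?v * (1 - fps_X ^ 4) + 4 * J * ?v"
    unfolding pJ by (simp add: algebra_simps)
  also have "\<dots> = 1 + of_int (4 * 1) * ?G"
    unfolding v by (simp add: algebra_simps)
  finally have sq: "(?g * (1 + fps_X)) ^ 2 = 1 + of_int (4 * 1) * ?G" .
  have "?v \<in> fps_over \<int>"
    by (rule graded_integral[OF zsubring_Ints pell_exp_integral]) simp_all
  moreover have "fps_graded 4 (\<lambda>_ x. x) K \<in> fps_over \<int>"
    by (rule graded_integral[OF zsubring_Ints K(1)])
  ultimately have "?G \<in> fps_over \<int>"
    unfolding J_def by (intro fps_Ints_intros)
  then obtain K' where "K' \<in> fps_over \<int>" "?g * (1 + fps_X) = 1 + of_int (2 * 1) * K'"
    using fps_sqrt_integral[OF _ sq] by auto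
  then have "(1 + fps_X) * ?g \<in> fps_over \<int>"
    by (simp only: mult.commute[of "1 + fps_X"]) (intro fps_Ints_intros)
  then show ?thesis
    by (rule fps_over_cancel[OF zsubring_Ints, rotated -1]) (intro fps_Ints_intros, simp)
qed

text \<open>The signs depend on \<open>k\<close> modulo 4. If 4 divides \<open>k\<close>, then
  \<open>eps (k * s)\<close> is always -1 and the alternating sign remains. If \<open>k\<close> is
  twice an odd number, \<open>eps (k * s)\<close> is -1 exactly for even \<open>s\<close> and
  cancels the alternating sign. Both cases reduce to \<open>pell_exp k\<close> for even
  \<open>k\<close>.\<close>

lemma witt_exp_integral:
  assumes k: "k > 0"
  shows "fps_expQ (witt_log k) \<in> fps_over \<int>"
proof -
  consider "odd k" | "4 dvd k" | j where "odd j" "k = 2 * j"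
  proof -
    have "odd k \<or> 4 dvd k \<or> (\<exists>j. odd j \<and> k = 2 * j)" by presburger
    then show thesis using that by blast
  qed
  then show ?thesis
  proof cases
    case 1
    then show ?thesis by (rule witt_exp_odd)
  next
    case 2
    then have "witt_log k $ s = fps_alt (pell_log k) $ s" for s
      using k by (cases "s = 0") (auto simp: witt_log_nth eps_def minus_one_power_pred)
    then have "witt_log k = fps_alt (pell_log k)" by (rule fps_ext)
    then have "fps_expQ (witt_log k) = fps_alt (pell_exp k)"
      by (simp add: pell_exp_def alt.graded_expQ)
    moreover have "pell_exp k \<in> fps_over \<int>"
      using 2 by (intro pell_exp_integral) (auto elim!: dvdE)
    ultimately show ?thesis
      by (simp only: fps_alt_def) (rule graded_integral[OF zsubring_Ints], auto)
  next
    case (3 j)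
    have "4 dvd k * s \<longleftrightarrow> even s" for s
      using 3 dvd_mult_cancel_left[of 2 2 "j * s"] by (simp add: mult.assoc)
    then have "witt_log k $ s = pell_log k $ s" for s
      using k by (cases "s = 0") (auto simp: witt_log_nth eps_def minus_one_power_pred)
    then have "witt_log k = pell_log k" by (rule fps_ext)
    then show ?thesis using pell_exp_integral[of k] 3 by (simp add: pell_exp_def)
  qed
qed

section \<open>Witt coordinates\<close>

text \<open>These are the \<open>c_k\<close> for which \<open>hhat eps p\<close> has the generating
  series with factors \<open>1 + c_k u^k\<close>. Comparing logarithms at \<open>u^n / n\<close>,
  the term \<open>(-1)^(n-1) eps_n p_n\<close> is the sum of \<open>k (-1)^(n/k-1) c_k^(n/k)\<close>
  over the divisors \<open>k\<close> of \<open>n\<close>; the recursion solves this for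
  \<open>k = n\<close>.\<close>

fun witt_coord :: "(nat \<Rightarrow> 'a::rat_algebra_1) \<Rightarrow> nat \<Rightarrow> 'a" where
  "witt_coord p n = (1 / of_nat n) *\<^sub>Q (((-1) ^ (n - 1) * eps n) *\<^sub>Q p n
     - (\<Sum>k<n. if k > 0 \<and> k dvd n
          then (of_nat k * (-1) ^ (n div k - 1)) *\<^sub>Q witt_coord p k ^ (n div k) else 0))"

declare witt_coord.simps [simp del]

lemma witt_coord_sum:
  assumes "n > 0" "n \<le> N"
  shows "((-1) ^ (n - 1) * eps n) *\<^sub>Q p n
    = (\<Sum>k<N. if Suc k dvd n
        then (of_nat (Suc k) * (-1) ^ (n div Suc k - 1)) *\<^sub>Q witt_coord p (Suc k) ^ (n div Suc k) else 0)"
proof -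
  let ?f = "\<lambda>k. if k > 0 \<and> k dvd n
    then (of_nat k * (-1) ^ (n div k - 1)) *\<^sub>Q witt_coord p k ^ (n div k) else 0"
  have "of_nat n *\<^sub>Q witt_coord p n = ((-1) ^ (n - 1) * eps n) *\<^sub>Q p n - (\<Sum>k<n. ?f k)"
    using assms by (subst witt_coord.simps) simp
  then have "((-1) ^ (n - 1) * eps n) *\<^sub>Q p n = (\<Sum>k<Suc n. ?f k)"
    using assms by (simp add: algebra_simps)
  also have "\<dots> = (\<Sum>k<Suc N. ?f k)"
    by (rule sum.mono_neutral_left) (use assms in \<open>auto dest: dvd_imp_le\<close>)
  finally show ?thesis by (simp add: sum.lessThan_Suc_shift del: sum.lessThan_Suc of_nat_Suc)
qed

lemma witt_coord_commute:
  assumes "\<And>r. x * p r = p r * x"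
  shows "x * witt_coord p n = witt_coord p n * x"
proof (induction n rule: less_induct)
  case (less n)
  have "(\<Sum>k<n. x * (if k > 0 \<and> k dvd n
          then (of_nat k * (-1) ^ (n div k - 1)) *\<^sub>Q witt_coord p k ^ (n div k) else 0))
    = (\<Sum>k<n. (if k > 0 \<and> k dvd n
          then (of_nat k * (-1) ^ (n div k - 1)) *\<^sub>Q witt_coord p k ^ (n div k) else 0) * x)"
    by (rule sum.cong) (simp_all add: less power_commuting_commutes)
  then show ?case
    by (subst (1 2) witt_coord.simps) (simp add: right_diff_distrib left_diff_distrib
      sum_distrib_left sum_distrib_right assms)
qed

abbreviation witt_series :: "(nat \<Rightarrow> 'a::rat_algebra_1) \<Rightarrow> nat \<Rightarrow> rat fps \<Rightarrow> 'a fps" where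
  "witt_series p k \<equiv> fps_graded (Suc k) (\<lambda>n q. q *\<^sub>Q witt_coord p (Suc k) ^ n)"

lemma graded_hom_power: "graded_hom (Suc k) (\<lambda>n q. q *\<^sub>Q c ^ n)"
  by unfold_locales (simp_all add: scaleQ_add_left power_add mult.commute)

lemma fps_commute:
  assumes "\<And>i j. F $ i * G $ j = G $ j * F $ i"
  shows "F * G = G * (F :: 'a::semiring_0 fps)"
proof (rule fps_ext)
  fix n
  have "(\<Sum>i=0..n. F $ i * G $ (n - i)) = (\<Sum>i=0..n. F $ (n - i) * G $ i)"
    by (rule sum.reindex_bij_witness[where i = "\<lambda>i. n - i" and j = "\<lambda>i. n - i"]) auto
  then show "(F * G) $ n = (G * F) $ n" by (simp add: fps_mult_nth assms)
qed

definition twisted_log :: "(nat \<Rightarrow> rat) \<Rightarrow> nat \<Rightarrow> rat fps" where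
  "twisted_log a k = Abs_fps (\<lambda>s. (-1) ^ (s - 1) * a (k * s) * eps (k * s) / of_nat s)"

lemma twisted_log_0 [simp]: "twisted_log a k $ 0 = 0"
  by (simp add: twisted_log_def)

lemma eps_square: "eps n * eps n = 1"
  by (simp add: eps_def)

context
  fixes p :: "nat \<Rightarrow> 'a::rat_algebra_1"
  assumes p_commute: "\<And>r s. p r * p s = p s * p r"
begin

lemma witt_coord_commute_self: "witt_coord p i * witt_coord p j = witt_coord p j * witt_coord p i"
  by (rule witt_coord_commute, rule sym, rule witt_coord_commute, rule p_commute)

text \<open>On the level of logarithms: \<open>a_n\<close> is written as
  \<open>(a_n eps_n) eps_n\<close>, and \<open>eps_n p_n\<close> is expanded in the Witt
  coordinates. Factors of index above \<open>N\<close> would start beyond degree \<open>n\<close>,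
  so the finite product is exact there.\<close>

lemma hhat_eq_prod:
  assumes "n \<le> N"
  shows "hhat a p n
    = prod_list (map (\<lambda>k. witt_series p k (fps_expQ (twisted_log a (Suc k)))) [0..<N]) $ n"
proof -
  let ?E = "Abs_fps (\<lambda>r. if r = 0 then 0 else ((-1) ^ (r - 1) * a r / of_nat r) *\<^sub>Q p r)"
  let ?Y = "\<lambda>k. witt_series p k (twisted_log a (Suc k))"
  have Y0: "?Y k $ 0 = 0" for k by (simp add: fps_graded_def)
  have E: "?E $ i = (\<Sum>k<N. ?Y k) $ i" if "i \<le> n" for i
  proof (cases "i = 0")
    case True
    then show ?thesis by (simp add: fps_sum_nth Y0)
  next
    case False
    have "?E $ i = (a i * eps i / of_nat i) *\<^sub>Q (((-1) ^ (i - 1) * eps i) *\<^sub>Q p i)"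
      using False eps_square[of i] by (simp add: mult_ac)
    also have "\<dots> = (\<Sum>k<N. ?Y k $ i)"
    proof (subst witt_coord_sum[where N = N])
      show "(a i * eps i / rat_of_nat i) *\<^sub>Q
        (\<Sum>k<N. if Suc k dvd i then (of_nat (Suc k) * (-1) ^ (i div Suc k - 1)) *\<^sub>Q
          witt_coord p (Suc k) ^ (i div Suc k) else 0) = (\<Sum>k<N. ?Y k $ i)"
        unfolding ratvs.scale_sum_right
      proof (rule sum.cong[OF refl])
        fix k
        show "(a i * eps i / rat_of_nat i) *\<^sub>Q (if Suc k dvd i
          then (of_nat (Suc k) * (-1) ^ (i div Suc k - 1)) *\<^sub>Q witt_coord p (Suc k) ^ (i div Suc k)
          else 0) = ?Y k $ i"
        proof (cases "Suc k dvd i")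
          case True
          then obtain s where "i = Suc k * s" ..
          with False show ?thesis
            by (simp add: fps_graded_def twisted_log_def del: of_nat_Suc mult_Suc)
        qed (simp add: fps_graded_def)
      qed
    qed (use False that assms in auto)
    finally show ?thesis by (simp add: fps_sum_nth)
  qed
  have "?Y i * ?Y j = ?Y j * ?Y i" for i j
  proof (rule fps_commute)
    fix m n
    have "witt_coord p (Suc i) ^ k * witt_coord p (Suc j) ^ l = witt_coord p (Suc j) ^ l * witt_coord p (Suc i) ^ k" for k l
      by (metis power_commuting_commutes witt_coord_commute_self)
    then show "?Y i $ m * ?Y j $ n = ?Y j $ n * ?Y i $ m"
      by (simp add: fps_graded_def mult.commute)
  qed
  then have "fps_expQ (\<Sum>k<N. ?Y k) = prod_list (map (\<lambda>k. fps_expQ (?Y k)) [0..<N])"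
    using Y0 by (intro fps_expQ_prod)
  moreover have "hhat a p n = fps_expQ (\<Sum>k<N. ?Y k) $ n"
    unfolding hhat_def by (rule fps_expQ_nth_cong) (rule E)
  ultimately show ?thesis
    by (simp add: graded_hom.graded_expQ[OF graded_hom_power])
qed

text \<open>For \<open>a = eps\<close> the signs square to 1 and every one-variable factor is
  \<open>1 + u\<close>. Degree \<open>n\<close> of the product is then \<open>c_n\<close> plus an
  integral polynomial in the earlier \<open>c_k\<close>, and induction applies.\<close>

lemma witt_coord_in_zsubalg:
  assumes "n > 0"
  shows "witt_coord p n \<in> zsubalg {hhat eps p k | k. k > 0}" (is "_ \<in> ?S")
  using assms
proof (induction n rule: less_induct)
  case (less n)
  have S: "zsubring ?S" by (rule zsubring_zsubalg)
  have exp: "fps_expQ (twisted_log eps k) = 1 + fps_X" if "k > 0" for k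
  proof -
    let ?G = "fps_expQ (twisted_log eps k)" and ?L = "twisted_log eps k"
    have L: "fps_deriv ?L * (1 + fps_X) = 1"
    proof (rule fps_ext)
      fix n
      show "(fps_deriv ?L * (1 + fps_X)) $ n = 1 $ n"
        using eps_square by (cases n) (simp_all add: distrib_left twisted_log_def mult.assoc del: of_nat_Suc)
    qed
    have "fps_deriv ?G = ?G * fps_deriv ?L"
      by (rule fps_deriv_fps_expQ) (simp_all add: mult.commute)
    then have "fps_deriv (?G * inverse (1 + fps_X)) = ?G * (fps_deriv ?L - inverse (1 + fps_X)) * inverse (1 + fps_X)"
      by (simp add: fps_inverse_deriv power2_eq_square algebra_simps)
    also have "fps_deriv ?L = inverse (1 + fps_X)"
      using L by (metis fps_inverse_unique mult.commute)
    finally have "fps_deriv (?G * inverse (1 + fps_X)) = 0" by simp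
    then have "?G * inverse (1 + fps_X) = fps_const ((?G * inverse (1 + fps_X)) $ 0)"
      by (rule iffD1[OF fps_deriv_eq_0_iff])
    then have "?G * inverse (1 + fps_X) = 1" by simp
    then have "?G * (inverse (1 + fps_X) * (1 + fps_X)) = 1 + fps_X"
      by (simp only: mult.assoc[symmetric] mult_1_left)
    moreover have "inverse (1 + fps_X) * (1 + fps_X :: rat fps) = 1"
      by (rule inverse_mult_eq_1) simp
    ultimately show ?thesis by simp
  qed
  have ser: "witt_series p k (1 + fps_X) $ i
      = (if i = 0 then 1 else if i = Suc k then witt_coord p (Suc k) else 0)" for k i
  proof (cases "Suc k dvd i")
    case True
    then obtain s where "i = Suc k * s" ..
    then show ?thesis by (auto simp: fps_graded_def simp del: mult_Suc mult_Suc_right)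
  qed (auto simp: fps_graded_def intro!: Nat.gr0I)
  obtain m where m: "n = Suc m" using less.prems by (cases n) auto
  let ?P = "prod_list (map (\<lambda>k. witt_series p k (1 + fps_X)) [0..<m])"
  have "witt_series p k (1 + fps_X) \<in> fps_over ?S" if "k < m" for k
    using less.IH[of "Suc k"] that m
    by (auto simp: fps_over_def ser zsubring_one[OF S] zsubring_zero[OF S])
  then have P: "?P \<in> fps_over ?S"
    by (intro zsubring_prod_list[OF zsubring_fps_over[OF S]]) auto
  have P0: "prod_list (map (\<lambda>k. witt_series p k (1 + fps_X)) [0..<j]) $ 0 = 1" for j
    by (induction j) (simp_all add: ser)
  have "hhat eps p n = (?P * witt_series p m (1 + fps_X)) $ n"
    by (subst hhat_eq_prod[OF order_refl]) (simp add: exp m)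
  also have "\<dots> = (\<Sum>i=0..n. ?P $ i * (if n - i = 0 then 1 else if n - i = Suc m then witt_coord p (Suc m) else 0))"
    by (simp add: fps_mult_nth ser m)
  also have "\<dots> = (\<Sum>i\<in>{0, n}. ?P $ i * (if n - i = 0 then 1 else if n - i = Suc m then witt_coord p (Suc m) else 0))"
    by (rule sum.mono_neutral_right) (auto simp: m)
  also have "\<dots> = witt_coord p n + ?P $ n"
    using less.prems by (simp add: P0 m)
  finally have "witt_coord p n = hhat eps p n - ?P $ n" by simp
  also have "\<dots> \<in> ?S"
  proof (rule zsubring_diff[OF S])
    show "hhat eps p n \<in> ?S" using less.prems by (intro zsubalg.base) auto
    show "?P $ n \<in> ?S" using P by (simp add: fps_over_def)
  qed
  finally show ?case .
qed

lemma hhat_in_zsubalg: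
  assumes "\<And>k. k > 0 \<Longrightarrow> fps_expQ (twisted_log a k) \<in> fps_over \<int>"
  shows "hhat a p n \<in> zsubalg {hhat eps p k | k. k > 0}" (is "_ \<in> ?S")
proof -
  have S: "zsubring ?S" by (rule zsubring_zsubalg)
  have "witt_series p k (fps_expQ (twisted_log a (Suc k))) \<in> fps_over ?S" for k
    by (rule graded_integral[OF S assms])
      (auto intro!: zsubring_scaleQ_Ints[OF S] zsubring_power[OF S] witt_coord_in_zsubalg)
  then have "prod_list (map (\<lambda>k. witt_series p k (fps_expQ (twisted_log a (Suc k)))) [0..<n]) \<in> fps_over ?S"
    by (intro zsubring_prod_list[OF zsubring_fps_over[OF S]]) auto
  then show ?thesis by (simp add: hhat_eq_prod[OF order_refl] fps_over_def)
qed

end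

lemma witt_log_eq: "witt_log k = twisted_log d_seq k"
  by (simp add: witt_log_def twisted_log_def)

section \<open>The defining relations in the quotient algebra\<close>

lemma abs_ualg_mult: "abs_ualg (a * b) = abs_ualg a * abs_ualg b"
  and abs_ualg_add: "abs_ualg (a + b) = abs_ualg a + abs_ualg b"
  and abs_ualg_diff: "abs_ualg (a - b) = abs_ualg a - abs_ualg b"
  and abs_ualg_zero: "abs_ualg 0 = 0"
  and abs_ualg_fgen: "abs_ualg (fgen g) = ugen g"
  and abs_ualg_fconst: "abs_ualg (fconst q) = q *\<^sub>Q 1"
  by (simp_all add: times_ualg.abs_eq plus_ualg.abs_eq minus_ualg.abs_eq zero_ualg_def
      ugen.abs_eq scaleQ_ualg.abs_eq one_ualg_def)

lemmas abs_ualg_simps = fcomm_def abs_ualg_mult abs_ualg_add abs_ualg_diff abs_ualg_zero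
  abs_ualg_fgen abs_ualg_fconst

lemma abs_ualg_relator: "a \<in> relators \<Longrightarrow> abs_ualg a = 0"
  unfolding zero_ualg_def ualg.abs_eq_iff rel_equiv_def by (simp add: rel_ideal.base)

definition comm :: "'a::ring_1 \<Rightarrow> 'a \<Rightarrow> 'a" where
  "comm a b = a * b - b * a"

lemma comm_h_h: "r + s \<noteq> 0 \<Longrightarrow> comm (h_elt r) (h_elt s) = 0"
  using abs_ualg_relator[OF relators.h_h[of r s]] by (simp add: abs_ualg_simps comm_def)

lemma comm_h_x: "comm (h_elt r) (x_elt \<sigma> s) = (sg \<sigma> * 2 * (2 + (-1) powi (r - 1))) *\<^sub>Q x_elt \<sigma> (r + s)"
  using abs_ualg_relator[OF relators.h_x[of r \<sigma> s]] by (simp add: abs_ualg_simps comm_def)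

lemma hhat_d_integral: "hhat_d n \<in> zsubalg {htilde_pos k | k. k > 0}"
proof -
  have "h_elt (int r) * h_elt (int s) = h_elt (int s) * h_elt (int r)" for r s
    using comm_h_h[of "int r" "int s"] by (cases "r + s = 0") (auto simp: comm_def)
  then show ?thesis unfolding hhat_d_def htilde_pos_def
    by (rule hhat_in_zsubalg) (simp add: witt_exp_integral flip: witt_log_eq)
qed

section \<open>Commutators of weighted series\<close>

lemma comm_uminus_swap: "comm b a = - comm a b"
  by (simp add: comm_def)

lemma comm_eq_0: "comm a b = 0 \<longleftrightarrow> a * b = b * a"
  by (simp add: comm_def)

definition dilate :: "'a::rat_algebra_1 fps \<Rightarrow> 'a fps" where
  "dilate = fps_graded 2 (\<lambda>_ x. x)"

interpretation dilate: graded_hom 2 "\<lambda>_ (x :: 'a::rat_algebra_1). x"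
  rewrites "fps_graded 2 (\<lambda>_ (x :: 'a). x) = dilate"
  by unfold_locales (simp_all add: dilate_def)

lemma dilate_diff: "dilate (F - G) = dilate F - dilate G"
  by (rule fps_ext) (simp add: dilate_def fps_graded_def)

text \<open>
  Put \<open>u = z\<close> and \<open>v = p * z\<close>, where \<open>z\<close> is the outer variable and the powers of \<open>p\<close> are absorbed
  in the \<open>y n\<close>. Then \<open>u * v\<close> has \<open>z\<close>-degree 2, and \<open>weighted i y a\<close> is \<open>z ^ i\<close> times the result
  of substituting \<open>(u * v) ^ n\<close> times the \<open>n\<close>-th root vector for the \<open>n\<close>-th power in \<open>a\<close>. This
  gives all exponents positive \<open>z\<close>-degree.
\<close>

definition weighted :: "nat \<Rightarrow> (nat \<Rightarrow> 'a::rat_algebra_1) \<Rightarrow> rat fps \<Rightarrow> 'a fps" where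
  "weighted i y a = fps_X ^ i * dilate (Abs_fps (\<lambda>n. (a $ n) *\<^sub>Q y n))"

lemma weighted_nth:
  "weighted i y a $ m
    = (if i \<le> m \<and> even (m - i) then (a $ ((m - i) div 2)) *\<^sub>Q y ((m - i) div 2) else 0)"
  by (simp add: weighted_def fps_X_power_mult_nth dilate_def fps_graded_def not_le)

lemma weighted_add: "weighted i y (a + b) = weighted i y a + weighted i y b"
  and weighted_uminus: "weighted i y (- a) = - weighted i y a"
  and weighted_diff: "weighted i y (a - b) = weighted i y a - weighted i y b"
  and weighted_0 [simp]: "weighted i y 0 = 0"
  and weighted_const_mult: "weighted i y (fps_const q * a) = q *\<^sub>Q weighted i y a"
  by (simp_all add: fps_eq_iff weighted_nth scaleQ_add_left ratvs.scale_left_diff_distrib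
      del: even_diff_nat)

lemma weighted_nth_0: "i > 0 \<or> a $ 0 = 0 \<Longrightarrow> weighted i y a $ 0 = 0"
  by (auto simp: weighted_nth)

text \<open>The vectors \<open>X\<close> exist only for odd index, which an even series never
  selects. This makes brackets between \<open>x\<close>-series of equal parity vanish.\<close>

lemma weighted_even_eq_0:
  assumes "\<And>n. even n \<Longrightarrow> y n = 0" "fps_alt a = a"
  shows "weighted i y a = 0"
proof (rule fps_ext)
  have "a $ n = 0" if "odd n" for n
    using arg_cong[OF assms(2), of "\<lambda>F. F $ n"] that by simp
  then have "(a $ n) *\<^sub>Q y n = 0" for n
    using assms(1)[of n] by (cases "even n") auto
  then show "weighted i y a $ m = 0 $ m" for m
    by (simp add: weighted_nth)
qed

text \<open>A sign \<open>(-1) ^ r\<close> in a structure constant acts on the coefficient series as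
  \<open>fps_alt\<close>. A shift of the target index by \<open>t\<close> is a factor
  \<open>w^t\<close>, and \<open>w\<close> has z-degree 2; hence the balance
  \<open>i + j = k + 2 * t\<close>.\<close>

lemma comm_weighted:
  assumes rel: "\<And>r s. comm (y r) (y' s)
      = (c0 + c1 * (-1) ^ r + c2 * (-1) ^ s + c3 * (-1) ^ (r + s)) *\<^sub>Q y'' (r + s + t)"
    and k: "i + j = k + 2 * t"
  shows "comm (weighted i y a) (weighted j y' b) = weighted k y'' (fps_X ^ t *
    (fps_const c0 * (a * b) + fps_const c1 * (fps_alt a * b)
      + fps_const c2 * (a * fps_alt b) + fps_const c3 * (fps_alt a * fps_alt b)))"
    (is "_ = weighted k y'' (fps_X ^ t * ?c)")
proof -
  define T where "T y a = Abs_fps (\<lambda>n. (a $ n) *\<^sub>Q y n)" for y :: "nat \<Rightarrow> 'a" and a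
  have X: "(fps_X ^ i * F) * (fps_X ^ j * G) = fps_X ^ (i + j) * (F * G)" for i j and F G :: "'a fps"
  proof -
    have "(fps_X ^ i * F) * (fps_X ^ j * G) = fps_X ^ i * (F * fps_X ^ j) * G"
      by (simp only: mult.assoc)
    also have "F * fps_X ^ j = fps_X ^ j * F"
      by (rule fps_mult_fps_X_power_commute[symmetric])
    finally show ?thesis by (simp only: power_add mult.assoc)
  qed
  have "comm (weighted i y a) (weighted j y' b) = fps_X ^ (i + j) * dilate (comm (T y a) (T y' b))"
    unfolding comm_def weighted_def T_def[symmetric] X
    unfolding dilate_diff dilate.graded_mult right_diff_distrib add.commute[of j i] by (rule refl)
  also have "comm (T y a) (T y' b) = T (\<lambda>n. y'' (n + t)) ?c"
  proof (rule fps_ext)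
    fix n
    have "(\<Sum>r=0..n. (b $ r * a $ (n - r)) *\<^sub>Q (y' r * y (n - r)))
        = (\<Sum>r=0..n. (a $ r * b $ (n - r)) *\<^sub>Q (y' (n - r) * y r))"
      by (rule sum.reindex_bij_witness[where i = "\<lambda>i. n - i" and j = "\<lambda>i. n - i"]) (auto simp: mult.commute)
    then have "comm (T y a) (T y' b) $ n = (\<Sum>r=0..n. (a $ r * b $ (n - r)) *\<^sub>Q comm (y r) (y' (n - r)))"
      by (simp add: comm_def T_def fps_mult_nth sum_subtractf ratvs.scale_right_diff_distrib mult.commute)
    also have "\<dots> = (\<Sum>r=0..n. (a $ r * b $ (n - r) *
        (c0 + c1 * (-1) ^ r + c2 * (-1) ^ (n - r) + c3 * (-1) ^ n)) *\<^sub>Q y'' (n + t))"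
      by (rule sum.cong) (simp_all add: rel)
    also have "\<dots> = (\<Sum>r=0..n. a $ r * b $ (n - r) *
        (c0 + c1 * (-1) ^ r + c2 * (-1) ^ (n - r) + c3 * (-1) ^ n)) *\<^sub>Q y'' (n + t)"
      by (simp add: ratvs.scale_sum_left)
    also have "(\<Sum>r=0..n. a $ r * b $ (n - r) *
        (c0 + c1 * (-1) ^ r + c2 * (-1) ^ (n - r) + c3 * (-1) ^ n)) = ?c $ n"
    proof -
      have "(-1) ^ n * x = (-1) ^ r * ((-1) ^ (n - r) * (x::rat))" if "r \<le> n" for r x
        using that by (simp add: mult.assoc[symmetric] flip: power_add)
      then have "(\<Sum>r=0..n. a $ r * b $ (n - r) * (c3 * (-1) ^ n))
        = (\<Sum>r=0..n. c3 * (((-1) ^ r * a $ r) * ((-1) ^ (n - r) * b $ (n - r))))"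
        by (intro sum.cong) (simp_all add: mult_ac)
      then show ?thesis
        by (simp only: fps_add_nth fps_mult_left_const_nth fps_mult_nth[of a] fps_mult_nth[of "fps_alt a"]
            fps_alt_nth sum_distrib_left distrib_left sum.distrib) (simp add: mult_ac)
    qed
    finally show "comm (T y a) (T y' b) $ n = T (\<lambda>n. y'' (n + t)) ?c $ n"
      by (simp add: T_def)
  qed
  also have "fps_X ^ (i + j) * dilate (T (\<lambda>n. y'' (n + t)) ?c)
      = fps_X ^ k * (fps_X ^ (2 * t) * dilate (T (\<lambda>n. y'' (n + t)) ?c))"
    by (simp add: k power_add mult.assoc)
  also have "fps_X ^ (2 * t) * dilate (T (\<lambda>n. y'' (n + t)) ?c) = dilate (T y'' (fps_X ^ t * ?c))"
  proof -
    have X2: "dilate (fps_X ^ t) = (fps_X ^ (2 * t) :: 'a fps)"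
      by (rule fps_ext) (auto simp: dilate_def fps_graded_def)
    have "T y'' (fps_X ^ t * ?c) = fps_X ^ t * T (\<lambda>n. y'' (n + t)) ?c"
      by (rule fps_ext) (simp add: T_def fps_X_power_mult_nth)
    then show ?thesis by (simp add: dilate.graded_mult X2)
  qed
  finally show ?thesis by (simp add: weighted_def T_def)
qed

definition coeffwise :: "('a \<Rightarrow> 'b) \<Rightarrow> 'a fps \<Rightarrow> 'b fps" where
  "coeffwise \<delta> F = Abs_fps (\<lambda>n. \<delta> (F $ n))"

lemma coeffwise_nth [simp]: "coeffwise \<delta> F $ n = \<delta> (F $ n)"
  by (simp add: coeffwise_def)

locale algebra_derivation =
  fixes \<delta> :: "'a::rat_algebra_1 \<Rightarrow> 'a"
  assumes \<delta>_add: "\<delta> (x + y) = \<delta> x + \<delta> y"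
    and \<delta>_mult: "\<delta> (x * y) = x * \<delta> y + \<delta> x * y"
    and \<delta>_scaleQ: "\<delta> (q *\<^sub>Q x) = q *\<^sub>Q \<delta> x"
begin

lemma \<delta>_0: "\<delta> 0 = 0"
  using \<delta>_add[of 0 0] by simp

lemma \<delta>_sum: "\<delta> (\<Sum>i\<in>A. f i) = (\<Sum>i\<in>A. \<delta> (f i))"
  by (induction A rule: infinite_finite_induct) (simp_all add: \<delta>_0 \<delta>_add)

lemma coeffwise_mult: "coeffwise \<delta> (F * G) = F * coeffwise \<delta> G + coeffwise \<delta> F * G"
  by (rule fps_ext) (simp add: fps_mult_nth \<delta>_sum \<delta>_mult sum.distrib)

lemma coeffwise_expQ:
  assumes "Y $ 0 = 0" "comm Y (coeffwise \<delta> Y) = 0"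
  shows "coeffwise \<delta> (fps_expQ Y) = fps_expQ Y * coeffwise \<delta> Y"
  by (rule derivation_fps_expQ[where j = 0 and \<delta> = "\<lambda>_. \<delta>"])
    (use assms in \<open>simp_all add: \<delta>_add coeffwise_mult comm_eq_0\<close>)

lemma coeffwise_weighted:
  assumes "\<And>n. \<delta> (y n) = of_nat (n + t) *\<^sub>Q y n"
  shows "coeffwise \<delta> (weighted i y a) = weighted i y (of_nat t * a + fps_X * fps_deriv a)"
proof (rule fps_ext)
  fix m
  have "fps_X * fps_deriv a = Abs_fps (\<lambda>n. of_nat n * a $ n)"
    by (rule fps_mult_fps_X_deriv_shift)
  then have "(of_nat t * a + fps_X * fps_deriv a) $ n = of_nat (n + t) * a $ n" for n
    by (simp add: fps_of_nat[symmetric] distrib_right)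
  then show "coeffwise \<delta> (weighted i y a) $ m = weighted i y (of_nat t * a + fps_X * fps_deriv a) $ m"
    by (simp add: weighted_nth \<delta>_0 \<delta>_scaleQ assms mult.commute del: even_diff_nat)
qed

end

lemma fps_expQ_comm_0: "comm Y A = 0 \<Longrightarrow> Y $ 0 = 0 \<Longrightarrow> fps_expQ Y * A = A * fps_expQ Y"
  using fps_expQ_mult3[of Y A 0 0 0] by (simp add: comm_def)

lemma fps_expQ_comm_1:
  "Y $ 0 = 0 \<Longrightarrow> comm Y A = A1 \<Longrightarrow> comm Y A1 = 0 \<Longrightarrow> fps_expQ Y * A = (A + A1) * fps_expQ Y"
  using fps_expQ_mult3[of Y A A1 0 0] by (simp add: comm_def)

lemma fps_alt_add: "fps_alt (a + b) = fps_alt a + fps_alt b"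
  and fps_alt_diff: "fps_alt (a - b) = fps_alt a - fps_alt b"
  and fps_alt_uminus: "fps_alt (- a) = - fps_alt a"
  and fps_alt_X: "fps_alt fps_X = - fps_X"
  and fps_alt_alt: "fps_alt (fps_alt a) = a"
  and fps_alt_deriv: "fps_deriv (fps_alt a) = - fps_alt (fps_deriv a)"
  and fps_alt_numeral: "fps_alt (numeral n) = numeral n"
  by (rule fps_ext, simp add: algebra_simps numeral_fps_const flip: power_mult_distrib)+

lemmas fps_alt_simps = fps_alt_add fps_alt_diff fps_alt_uminus fps_alt_X fps_alt_alt
  fps_alt_numeral alt.graded_mult alt.graded_power alt.graded_one

section \<open>The coefficient series of the Gauss decomposition\<close>

text \<open>The denominator is \<open>f(w) * f(-w)\<close> for \<open>f = 1 + 2w - w^2\<close>. Over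
  it, \<open>gauss_even\<close> and \<open>gauss_odd\<close> are the even and odd parts of
  \<open>(1-w)/f\<close>.\<close>

definition gauss_inv :: "rat fps" where
  "gauss_inv = inverse (1 - 6 * fps_X ^ 2 + fps_X ^ 4)"

definition gauss_even :: "rat fps" where
  "gauss_even = (1 + fps_X ^ 2) * gauss_inv"

definition gauss_odd :: "rat fps" where
  "gauss_odd = (fps_X ^ 3 - 3 * fps_X) * gauss_inv"

text \<open>The coefficient series of the \<open>X\<close> vectors. It is forced by
  \<open>gauss_eq_P\<close>, where it enters without derivative.\<close>

definition gauss_X :: "rat fps" where
  "gauss_X = 2 * fps_X * (1 - fps_X ^ 2) * gauss_inv ^ 2"

lemma gauss_inv: "(1 - 6 * fps_X ^ 2 + fps_X ^ 4) * gauss_inv = 1"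
  unfolding gauss_inv_def by (subst mult.commute) (rule inverse_mult_eq_1, simp)

lemma gauss_inv_deriv: "fps_deriv gauss_inv = (12 * fps_X - 4 * fps_X ^ 3) * gauss_inv ^ 2"
proof -
  have "fps_deriv gauss_inv = - fps_deriv (1 - 6 * fps_X ^ 2 + fps_X ^ 4) * gauss_inv ^ 2"
    unfolding gauss_inv_def by (rule fps_inverse_deriv) simp
  also have "fps_deriv (1 - 6 * fps_X ^ 2 + fps_X ^ 4) = (4 * fps_X ^ 3 - 12 * fps_X :: rat fps)"
    by (simp add: fps_deriv_power algebra_simps numeral_fps_const[symmetric])
  finally show ?thesis by simp
qed

lemma gauss_alt:
  "fps_alt gauss_inv = gauss_inv" "fps_alt gauss_even = gauss_even"
  "fps_alt gauss_odd = - gauss_odd" "fps_alt gauss_X = - gauss_X"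
proof -
  have "(1 - 6 * fps_X ^ 2 + fps_X ^ 4) * fps_alt gauss_inv = 1"
    using arg_cong[OF gauss_inv, of fps_alt] by (simp add: fps_alt_simps)
  then show i: "fps_alt gauss_inv = gauss_inv"
    using gauss_inv by algebra
  show "fps_alt gauss_even = gauss_even" "fps_alt gauss_odd = - gauss_odd" "fps_alt gauss_X = - gauss_X"
    by (simp_all add: gauss_even_def gauss_odd_def gauss_X_def fps_alt_simps i algebra_simps)
qed

lemma gauss_deriv:
  "fps_deriv gauss_even = 2 * fps_X * gauss_inv + (1 + fps_X ^ 2) * (12 * fps_X - 4 * fps_X ^ 3) * gauss_inv ^ 2"
  "fps_deriv gauss_odd = (3 * fps_X ^ 2 - 3) * gauss_inv + (fps_X ^ 3 - 3 * fps_X) * (12 * fps_X - 4 * fps_X ^ 3) * gauss_inv ^ 2"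
  "fps_deriv gauss_X = (2 - 6 * fps_X ^ 2) * gauss_inv ^ 2
    + 4 * fps_X * (1 - fps_X ^ 2) * (12 * fps_X - 4 * fps_X ^ 3) * gauss_inv ^ 3"
  by (simp_all add: gauss_even_def gauss_odd_def gauss_X_def gauss_inv_deriv fps_deriv_power
      algebra_simps power2_eq_square power3_eq_cube numeral_fps_const[symmetric])

text \<open>This is the comparison of the \<open>x^+\<close> terms in \<open>Np_M_\<Theta>\<close>;
  \<open>gauss_eq_X\<close> is that of the \<open>X^+\<close> terms there, and
  \<open>gauss_eq_Xm\<close> removes the \<open>X^-\<close> terms in
  \<open>\<Theta>_Nm\<close>.\<close>

lemma gauss_eq_P:
  "fps_deriv (gauss_even + gauss_odd) + 3 * gauss_even ^ 2 + 2 * (gauss_even * gauss_odd)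
    + gauss_odd ^ 2 - 4 * gauss_X = 0"
  unfolding gauss_deriv fps_deriv_add unfolding gauss_even_def gauss_odd_def gauss_X_def
  using gauss_inv by algebra

lemma gauss_eq_X:
  "fps_deriv gauss_X + gauss_even * fps_deriv gauss_odd + gauss_even ^ 3 + gauss_odd ^ 2 * gauss_even
    + 4 * (gauss_odd * gauss_X) = 0"
  unfolding gauss_deriv fps_deriv_add unfolding gauss_even_def gauss_odd_def gauss_X_def
  using gauss_inv by algebra

lemma gauss_eq_Xm:
  "2 * gauss_X + fps_X * fps_deriv gauss_X
    + (gauss_odd + fps_X * fps_deriv gauss_odd) * gauss_even = 0"
  unfolding gauss_deriv fps_deriv_add unfolding gauss_even_def gauss_odd_def gauss_X_def
  using gauss_inv by algebra

lemma half_log_series_0 [simp]: "half_log_series $ 0 = 0"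
  by (simp add: half_log_series_def)

lemma gauss_poly_neq_0:
  "(1 + 2 * fps_X - fps_X ^ 2 :: rat fps) \<noteq> 0" "(1 - 2 * fps_X - fps_X ^ 2 :: rat fps) \<noteq> 0"
proof -
  have "(1 + 2 * fps_X - fps_X ^ 2 :: rat fps) $ 0 \<noteq> 0 $ 0" "(1 - 2 * fps_X - fps_X ^ 2 :: rat fps) $ 0 \<noteq> 0 $ 0"
    by simp_all
  then show "(1 + 2 * fps_X - fps_X ^ 2 :: rat fps) \<noteq> 0" "(1 - 2 * fps_X - fps_X ^ 2 :: rat fps) \<noteq> 0"
    by metis+
qed

lemma gauss_sum:
  "(gauss_even + gauss_odd) * (1 + 2 * fps_X - fps_X ^ 2) = 1 - fps_X"
  "(gauss_even - gauss_odd) * (1 - 2 * fps_X - fps_X ^ 2) = 1 + fps_X"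
  unfolding gauss_even_def gauss_odd_def using gauss_inv by algebra+

lemma half_log_series_deriv_gauss: "fps_deriv half_log_series = gauss_even + gauss_odd"
  using half_log_series_deriv gauss_sum(1) gauss_poly_neq_0(1) by (metis mult_right_cancel)

text \<open>\<open>h_r\<close> acts on \<open>x^-\<close> with eigenvalue
  \<open>-(4 - 2 (-1)^r)\<close>, so conjugation by the diagonal factor multiplies coefficient
  series of \<open>x^-\<close> by the exponential of this series.\<close>

definition h_weight :: "rat fps" where
  "h_weight = 4 * half_log_series - 2 * fps_alt half_log_series"

lemma h_weight_0 [simp]: "h_weight $ 0 = 0"
  by (simp add: h_weight_def numeral_fps_const)

text \<open>With \<open>f\<close> and \<open>g\<close> as in the proof, the first factor is the
  derivative of \<open>w (1-w) / f\<close>, that is \<open>g / f^2\<close>, and the exponential is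
  \<open>f^2 / g\<close>. The proof shows that the product has derivative 0.\<close>

lemma gauss_h_weight:
  "(gauss_even + gauss_odd + fps_X * fps_deriv (gauss_even + gauss_odd)) * fps_expQ h_weight = 1"
  (is "?\<phi> * ?\<kappa> = 1")
proof -
  let ?a = "gauss_even + gauss_odd"
  have w: "fps_deriv h_weight = 4 * ?a + 2 * (gauss_even - gauss_odd)"
    by (simp add: h_weight_def fps_alt_deriv half_log_series_deriv_gauss fps_alt_simps gauss_alt)
  have "fps_deriv ?\<kappa> = ?\<kappa> * fps_deriv h_weight"
    by (rule fps_deriv_fps_expQ) (simp_all add: mult.commute)
  moreover have "fps_deriv ?\<phi> + ?\<phi> * fps_deriv h_weight = 0"
  proof -
    define f g :: "rat fps" where "f = 1 + 2 * fps_X - fps_X ^ 2" and "g = 1 - 2 * fps_X - fps_X ^ 2"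
    have f': "fps_deriv f = 2 - 2 * fps_X" and g': "fps_deriv g = - 2 - 2 * fps_X"
      by (simp_all add: f_def g_def power2_eq_square)
    have af: "?a * f = 1 - fps_X" and ag: "(gauss_even - gauss_odd) * g = 1 + fps_X"
      using gauss_sum by (simp_all add: f_def g_def)
    have "?a * fps_deriv f + fps_deriv ?a * f = - 1"
      using arg_cong[OF af, of fps_deriv] by simp
    then have \<phi>: "?\<phi> * f ^ 2 = g"
      using af f' f_def g_def by algebra
    have "f * fps_deriv f + fps_deriv f * f = 2 * f * fps_deriv f" by algebra
    then have "?\<phi> * (2 * f * fps_deriv f) + fps_deriv ?\<phi> * f ^ 2 = fps_deriv g"
      using arg_cong[OF \<phi>, of fps_deriv]
      unfolding power2_eq_square fps_deriv_mult[of ?\<phi>] fps_deriv_mult[of f] by (simp only:)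
    \<comment> \<open>The factor \<open>f ^ 3 * g\<close> clears all denominators.\<close>
    then have "(f ^ 3 * g) * (fps_deriv ?\<phi> + ?\<phi> * fps_deriv h_weight) = 0"
      using \<phi> af ag w f' g' by algebra
    moreover have "f ^ 3 * g \<noteq> 0"
      using gauss_poly_neq_0 by (simp add: f_def g_def)
    ultimately show ?thesis by simp
  qed
  ultimately have "fps_deriv (?\<phi> * ?\<kappa>) = 0"
    unfolding fps_deriv_mult[of ?\<phi>] by algebra
  then have "?\<phi> * ?\<kappa> = fps_const ((?\<phi> * ?\<kappa>) $ 0)"
    by (rule iffD1[OF fps_deriv_eq_0_iff])
  moreover have "gauss_inv $ 0 = 1" by (simp add: gauss_inv_def)
  then have "(?\<phi> * ?\<kappa>) $ 0 = 1"
    by (simp add: gauss_even_def gauss_odd_def fps_power_zeroth)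
  ultimately show ?thesis by simp
qed

lemma gauss_integral:
  "gauss_even \<in> fps_over \<int>" "gauss_odd \<in> fps_over \<int>" "gauss_X \<in> fps_over \<int>"
proof -
  have "gauss_inv \<in> fps_over \<int>"
    by (rule fps_over_cancel[OF zsubring_Ints, of "1 - 6 * fps_X ^ 2 + fps_X ^ 4"], unfold gauss_inv)
      (safe intro!: fps_Ints_intros, simp)
  then show "gauss_even \<in> fps_over \<int>" "gauss_odd \<in> fps_over \<int>" "gauss_X \<in> fps_over \<int>"
    unfolding gauss_even_def gauss_odd_def gauss_X_def
    by (safe intro!: fps_Ints_intros)
qed

section \<open>The differential equation\<close>

text \<open>In \<open>xp_xm\<close> the negative vector has index at least 1, so the index sum is
  positive and no central term occurs. \<delta> is the loop degree derivation.\<close>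

locale a22_positive_half = algebra_derivation \<delta>
  for \<delta> :: "'a::rat_algebra_1 \<Rightarrow> 'a" +
  fixes xp xm h Xp Xm :: "nat \<Rightarrow> 'a"
  assumes xp_xm: "comm (xp r) (xm (Suc s)) = h (Suc (r + s))"
    and h_xp: "comm (h r) (xp s) = (4 - 2 * (-1) ^ r) *\<^sub>Q xp (r + s)"
    and h_xm: "comm (h r) (xm s) = (2 * (-1) ^ r - 4) *\<^sub>Q xm (r + s)"
    and h_h: "comm (h r) (h s) = 0"
    and h_Xp: "comm (h r) (Xp s) = (2 + 2 * (-1) ^ r) *\<^sub>Q Xp (r + s)"
    and xp_xp: "comm (xp r) (xp s) = (-1) ^ s *\<^sub>Q Xp (r + s)"
    and xm_xm: "comm (xm r) (xm s) = - ((-1) ^ s) *\<^sub>Q Xm (r + s)"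
    and xm_Xp: "comm (xm r) (Xp s) = (2 * (-1) ^ (r + s) - 2 * (-1) ^ r) *\<^sub>Q xp (r + s)"
    and xp_Xp: "comm (xp r) (Xp s) = 0"
    and xm_Xm: "comm (xm r) (Xm s) = 0"
    and Xp_Xp: "comm (Xp r) (Xp s) = 0"
    and Xm_Xm: "comm (Xm r) (Xm s) = 0"
    and Xp_even: "even r \<Longrightarrow> Xp r = 0"
    and Xm_even: "even r \<Longrightarrow> Xm r = 0"
    and \<delta>_xp: "\<delta> (xp r) = of_nat r *\<^sub>Q xp r"
    and \<delta>_xm: "\<delta> (xm r) = of_nat r *\<^sub>Q xm r"
    and \<delta>_h: "\<delta> (h r) = of_nat r *\<^sub>Q h r"
    and \<delta>_Xp: "\<delta> (Xp r) = of_nat r *\<^sub>Q Xp r"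
    and \<delta>_Xm: "\<delta> (Xm r) = of_nat r *\<^sub>Q Xm r"
begin

text \<open>With \<open>w = u v\<close>, the power \<open>w^n\<close> is attached to
  \<open>u x_n\<close> in \<open>P\<close>, \<open>v x^-_(n+1)\<close> in \<open>M\<close>,
  \<open>h_n\<close> in \<open>K\<close>, \<open>u^2 X_n\<close> in \<open>Qp\<close> and
  \<open>v^2 X^-_(n+2)\<close> in \<open>Qm\<close>. Thus \<open>P 1\<close> is
  \<open>x_0^+ u\<close> and \<open>M 1\<close> is \<open>x_1^- v\<close>.\<close>

definition P where "P = weighted 1 xp"
definition M where "M = weighted 1 (\<lambda>n. xm (Suc n))"
definition K where "K = weighted 0 h"
definition Qp where "Qp = weighted 2 Xp"
definition Qm where "Qm = weighted 2 (\<lambda>n. Xm (n + 2))"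

lemmas series_defs = P_def M_def K_def Qp_def Qm_def

lemma series_linear:
  "P (a + b) = P a + P b" "M (a + b) = M a + M b" "K (a + b) = K a + K b"
  "Qp (a + b) = Qp a + Qp b" "Qm (a + b) = Qm a + Qm b"
  "P (a - b) = P a - P b" "M (a - b) = M a - M b" "K (a - b) = K a - K b"
  "Qp (a - b) = Qp a - Qp b" "Qm (a - b) = Qm a - Qm b"
  "P (- a) = - P a" "M (- a) = - M a" "K (- a) = - K a" "Qp (- a) = - Qp a" "Qm (- a) = - Qm a"
  "P 0 = 0" "M 0 = 0" "K 0 = 0" "Qp 0 = 0" "Qm 0 = 0"
  by (simp_all add: series_defs weighted_add weighted_diff weighted_uminus)

lemma series_nth_0 [simp]:
  "P a $ 0 = 0" "M a $ 0 = 0" "a $ 0 = 0 \<Longrightarrow> K a $ 0 = 0" "Qp a $ 0 = 0" "Qm a $ 0 = 0"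
  by (simp_all add: series_defs weighted_nth_0)

lemma Qp_even: "fps_alt a = a \<Longrightarrow> Qp a = 0"
  by (simp add: Qp_def weighted_even_eq_0 Xp_even)

lemma Qm_even: "fps_alt a = a \<Longrightarrow> Qm a = 0"
  by (simp add: Qm_def weighted_even_eq_0 Xm_even)

lemma comm_P_M: "comm (P a) (M b) = K (fps_X * (a * b))"
  unfolding series_defs
  by (subst comm_weighted[where y'' = h and ?c0.0 = 1 and ?c1.0 = 0 and ?c2.0 = 0 and ?c3.0 = 0 and t = 1 and k = 0])
    (simp_all add: xp_xm)

lemma comm_K_P: "comm (K a) (P b) = P (4 * a * b - 2 * fps_alt a * b)"
  unfolding series_defs
  by (subst comm_weighted[where y'' = xp and ?c0.0 = 4 and ?c1.0 = "-2" and ?c2.0 = 0 and ?c3.0 = 0 and t = 0 and k = 1])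
    (simp_all add: h_xp numeral_fps_const mult.assoc fps_const_neg[symmetric] del: fps_const_neg)

lemma comm_K_M: "comm (K a) (M b) = - M (4 * a * b - 2 * fps_alt a * b)"
  unfolding series_defs weighted_uminus[symmetric]
  by (subst comm_weighted[where y'' = "\<lambda>n. xm (Suc n)" and ?c0.0 = "-4" and ?c1.0 = 2 and ?c2.0 = 0 and ?c3.0 = 0 and t = 0 and k = 1])
    (simp_all add: h_xm numeral_fps_const mult.assoc fps_const_neg[symmetric] del: fps_const_neg)

lemma comm_K_K: "comm (K a) (K b) = 0"
  unfolding series_defs
  by (subst comm_weighted[where y'' = h and ?c0.0 = 0 and ?c1.0 = 0 and ?c2.0 = 0 and ?c3.0 = 0 and t = 0 and k = 0])
    (simp_all add: h_h)

lemma comm_K_Qp: "comm (K a) (Qp b) = Qp (2 * a * b + 2 * fps_alt a * b)"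
  unfolding series_defs
  by (subst comm_weighted[where y'' = Xp and ?c0.0 = 2 and ?c1.0 = 2 and ?c2.0 = 0 and ?c3.0 = 0 and t = 0 and k = 2])
    (simp_all add: h_Xp numeral_fps_const mult.assoc)

lemma comm_P_P: "comm (P a) (P b) = Qp (a * fps_alt b)"
  unfolding series_defs
  by (subst comm_weighted[where y'' = Xp and ?c0.0 = 0 and ?c1.0 = 0 and ?c2.0 = 1 and ?c3.0 = 0 and t = 0 and k = 2])
    (simp_all add: xp_xp)

text \<open>The index shift in \<open>M\<close> absorbs the minus sign of \<open>xm_xm\<close>, so
  \<open>P\<close> and \<open>M\<close> obey the same rule.\<close>

lemma comm_M_M: "comm (M a) (M b) = Qm (a * fps_alt b)"
  unfolding series_defs
  by (subst comm_weighted[where y'' = "\<lambda>n. Xm (n + 2)" and ?c0.0 = 0 and ?c1.0 = 0 and ?c2.0 = 1 and ?c3.0 = 0 and t = 0 and k = 2])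
    (simp_all add: xm_xm)

lemma comm_M_Qp: "comm (M a) (Qp b) = P (fps_X * (2 * fps_alt a * b - 2 * fps_alt a * fps_alt b))"
  unfolding series_defs
  by (subst comm_weighted[where y'' = xp and ?c0.0 = 0 and ?c1.0 = 2 and ?c2.0 = 0 and ?c3.0 = "-2" and t = 1 and k = 1])
    (simp_all add: xm_Xp numeral_fps_const mult.assoc fps_const_neg[symmetric] del: fps_const_neg)

lemma comm_series_0: "comm (P a) (Qp b) = 0" "comm (M a) (Qm b) = 0"
    "comm (Qp a) (Qp b) = 0" "comm (Qm a) (Qm b) = 0"
    "comm (Qp a) (P b) = 0" "comm (Qm a) (M b) = 0"
proof -
  show 1: "comm (P a) (Qp b) = 0" for a b
    unfolding series_defs
    by (subst comm_weighted[where y'' = h and ?c0.0 = 0 and ?c1.0 = 0 and ?c2.0 = 0 and ?c3.0 = 0 and t = 0 and k = 3])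
      (simp_all add: xp_Xp)
  show 2: "comm (M a) (Qm b) = 0" for a b
    unfolding series_defs
    by (subst comm_weighted[where y'' = h and ?c0.0 = 0 and ?c1.0 = 0 and ?c2.0 = 0 and ?c3.0 = 0 and t = 0 and k = 3])
      (simp_all add: xm_Xm)
  show "comm (Qp a) (Qp b) = 0"
    unfolding series_defs
    by (subst comm_weighted[where y'' = h and ?c0.0 = 0 and ?c1.0 = 0 and ?c2.0 = 0 and ?c3.0 = 0 and t = 0 and k = 4])
      (simp_all add: Xp_Xp)
  show "comm (Qm a) (Qm b) = 0"
    unfolding series_defs
    by (subst comm_weighted[where y'' = h and ?c0.0 = 0 and ?c1.0 = 0 and ?c2.0 = 0 and ?c3.0 = 0 and t = 0 and k = 4])
      (simp_all add: Xm_Xm)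
  show "comm (Qp a) (P b) = 0" "comm (Qm a) (M b) = 0"
    using 1[of b a] 2[of b a] by (simp_all add: comm_uminus_swap[of "Qp a"] comm_uminus_swap[of "Qm a"])
qed

abbreviation \<Theta> where "\<Theta> \<equiv> coeffwise \<delta>"

text \<open>\<Theta> is \<open>v d/dv\<close>: it acts on coefficient series as
  \<open>w d/dw\<close>, plus the v-degree of the prefactor, which is 1 for \<open>M\<close> and 2
  for \<open>Qm\<close>.\<close>

lemma \<Theta>_series:
  "\<Theta> (P a) = P (fps_X * fps_deriv a)" "\<Theta> (M a) = M (a + fps_X * fps_deriv a)"
  "\<Theta> (K a) = K (fps_X * fps_deriv a)" "\<Theta> (Qp a) = Qp (fps_X * fps_deriv a)"
  "\<Theta> (Qm a) = Qm (2 * a + fps_X * fps_deriv a)"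
  unfolding series_defs
  using coeffwise_weighted[of xp 0 1 a] coeffwise_weighted[of "\<lambda>n. xm (Suc n)" 1 1 a]
    coeffwise_weighted[of h 0 0 a] coeffwise_weighted[of Xp 0 2 a]
    coeffwise_weighted[of "\<lambda>n. Xm (n + 2)" 2 2 a]
  by (simp_all add: \<delta>_xp \<delta>_xm \<delta>_h \<delta>_Xp \<delta>_Xm)

abbreviation "E \<equiv> fps_expQ"
abbreviation e where "e \<equiv> gauss_even"
abbreviation d where "d \<equiv> gauss_odd"
abbreviation g where "g \<equiv> gauss_X"
abbreviation w :: "rat fps" where "w \<equiv> fps_X"

lemma half_weighted: "(1/2) *\<^sub>Q P (2 * a) = P a" and sixth_weighted: "(1/6) *\<^sub>Q Qp (6 * a) = Qp a"
  by (simp_all add: series_defs numeral_fps_const weighted_const_mult)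

lemma comm_P_K: "comm (P b) (K a) = P (2 * fps_alt a * b - 4 * a * b)"
  unfolding comm_uminus_swap[of "P b"] comm_K_P series_linear(11)[symmetric] by simp

lemma comm_Qp_K: "comm (Qp b) (K a) = Qp (- (2 * a * b) - 2 * fps_alt a * b)"
  unfolding comm_uminus_swap[of "Qp b"] comm_K_Qp series_linear(14)[symmetric] by simp

lemma comm_Qp_M: "comm (Qp b) (M a) = P (w * (2 * fps_alt a * fps_alt b - 2 * fps_alt a * b))"
  unfolding comm_uminus_swap[of "Qp b"] comm_M_Qp series_linear(11)[symmetric] by (simp add: algebra_simps)

text \<open>The chain stops at \<open>x^+\<close>, since \<open>d\<close> and
  \<open>w * d ^ 2\<close> are both odd. In \<open>push_even_M\<close> the series \<open>e\<close>
  is even and \<open>w * e ^ 2\<close> odd, so there the last bracket reaches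
  \<open>X^+\<close>.\<close>

lemma push_odd_M: "E (P d) * M 1 = (M 1 + K (w * d) + P (- (w * d ^ 2))) * E (P d)"
proof -
  have 1: "comm (P d) (M 1) = K (w * d)" by (simp add: comm_P_M)
  have 2: "comm (P d) (K (w * d)) = P (2 * (- (w * d ^ 2)))"
    unfolding comm_P_K by (simp add: fps_alt_simps gauss_alt algebra_simps power2_eq_square)
  have 3: "comm (P d) (P (2 * (- (w * d ^ 2)))) = 0"
    unfolding comm_P_P by (rule Qp_even) (simp add: fps_alt_simps gauss_alt)
  show ?thesis
    using fps_expQ_mult3[of "P d" "M 1" "K (w * d)" "P (2 * (- (w * d ^ 2)))" 0] 1 2 3
    by (simp add: comm_def half_weighted del: mult_minus_right)
qed

lemma push_X_M: "E (Qp (- g)) * M 1 = (M 1 + P (4 * (w * g))) * E (Qp (- g))"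
proof (rule fps_expQ_comm_1)
  show "comm (Qp (- g)) (M 1) = P (4 * (w * g))"
    unfolding comm_Qp_M by (simp add: fps_alt_simps gauss_alt algebra_simps)
qed (simp_all add: comm_series_0)

lemma push_X_K: "E (Qp (- g)) * K (w * d) = (K (w * d) + Qp (4 * (w * d * g))) * E (Qp (- g))"
proof (rule fps_expQ_comm_1)
  show "comm (Qp (- g)) (K (w * d)) = Qp (4 * (w * d * g))"
    unfolding comm_Qp_K by (simp add: fps_alt_simps gauss_alt algebra_simps)
qed (simp_all add: comm_series_0)

lemma push_X_P: "E (Qp (- g)) * P a = P a * E (Qp (- g))"
  by (rule fps_expQ_comm_0) (simp_all add: comm_series_0)

lemma push_even_M:
  "E (P e) * M 1 = (M 1 + K (w * e) + P (- (3 * (w * e ^ 2))) + Qp (w * e ^ 3)) * E (P e)"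
proof -
  have 1: "comm (P e) (M 1) = K (w * e)" by (simp add: comm_P_M)
  have 2: "comm (P e) (K (w * e)) = P (2 * (- (3 * (w * e ^ 2))))"
    unfolding comm_P_K by (simp add: fps_alt_simps gauss_alt algebra_simps power2_eq_square)
  have 3: "comm (P e) (P (2 * (- (3 * (w * e ^ 2))))) = Qp (6 * (w * e ^ 3))"
    unfolding comm_P_P by (simp add: fps_alt_simps gauss_alt algebra_simps power2_eq_square power3_eq_cube)
  have 4: "comm (P e) (Qp (6 * (w * e ^ 3))) = 0"
    by (rule comm_series_0)
  show ?thesis
    using fps_expQ_mult3[of "P e" "M 1" "K (w * e)" "P (2 * (- (3 * (w * e ^ 2))))" "Qp (6 * (w * e ^ 3))"] 1 2 3 4
    by (simp add: comm_def half_weighted sixth_weighted del: mult_minus_right)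
qed

lemma push_even_K: "E (P e) * K (w * d) = (K (w * d) + P (- (2 * (w * d * e)))) * E (P e)"
proof (rule fps_expQ_comm_1)
  show "comm (P e) (K (w * d)) = P (- (2 * (w * d * e)))"
    unfolding comm_P_K by (simp add: fps_alt_simps gauss_alt algebra_simps)
  show "comm (P e) (P (- (2 * (w * d * e)))) = 0"
    unfolding comm_P_P by (rule Qp_even) (simp add: fps_alt_simps gauss_alt)
qed simp

lemma push_even_P: "E (P e) * P a = (P a + Qp (e * fps_alt a)) * E (P e)"
  by (rule fps_expQ_comm_1) (simp_all add: comm_P_P comm_series_0)

lemma push_even_X: "E (P e) * Qp a = Qp a * E (P e)"
  by (rule fps_expQ_comm_0) (simp_all add: comm_series_0)

text \<open>\<open>Nm\<close> is the mirror image of \<open>Np\<close>. As \<open>P\<close> and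
  \<open>M\<close> have the same brackets, reversing the order of the factors changes the sign of
  the \<open>X\<close> exponent.\<close>

definition Np where "Np = E (P e) * E (Qp (- g)) * E (P d)"
definition Nm where "Nm = E (M d) * E (Qm g) * E (M e)"

lemma Np_M:
  "Np * M 1 = (M 1 + K (w * (e + d)) + P (- (3 * (w * e ^ 2)) - 2 * (w * d * e) - w * d ^ 2 + 4 * (w * g))
    + Qp (w * e ^ 3 + w * d ^ 2 * e + 4 * (w * d * g))) * Np"
proof -
  have 0: "Qp (e * fps_alt (4 * (w * g))) = 0"
    by (rule Qp_even) (simp add: fps_alt_simps gauss_alt)
  have 1: "Qp (e * fps_alt (- (w * d ^ 2))) = Qp (w * d ^ 2 * e)"
    by (simp add: fps_alt_simps gauss_alt mult_ac)
  have "Np * M 1 = E (P e) * (E (Qp (- g)) * (E (P d) * M 1))"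
    by (simp add: Np_def mult.assoc)
  also have "\<dots> = E (P e) * (E (Qp (- g)) * M 1 + E (Qp (- g)) * K (w * d) + E (Qp (- g)) * P (- (w * d ^ 2))) * E (P d)"
    by (simp add: push_odd_M distrib_left distrib_right mult.assoc)
  also have "\<dots> = (E (P e) * M 1 + E (P e) * P (4 * (w * g)) + E (P e) * K (w * d)
      + E (P e) * Qp (4 * (w * d * g)) + E (P e) * P (- (w * d ^ 2))) * E (Qp (- g)) * E (P d)"
    by (simp only: push_X_M push_X_K push_X_P) (simp add: distrib_left distrib_right mult.assoc)
  also have "\<dots> = (M 1 + K (w * (e + d)) + P (- (3 * (w * e ^ 2)) - 2 * (w * d * e) - w * d ^ 2 + 4 * (w * g))
    + Qp (w * e ^ 3 + w * d ^ 2 * e + 4 * (w * d * g))) * Np"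
    by (simp only: push_even_M push_even_P push_even_K push_even_X 0 1)
      (simp add: distrib_left distrib_right mult.assoc Np_def series_linear left_diff_distrib)
  finally show ?thesis .
qed

lemma \<Theta>_E_P: "comm (P a) (P (w * fps_deriv a)) = 0 \<Longrightarrow> \<Theta> (E (P a)) = P (w * fps_deriv a) * E (P a)"
  by (subst coeffwise_expQ) (simp_all add: \<Theta>_series fps_expQ_comm_0)

lemma gauss_deriv_alt: "fps_alt (fps_deriv e) = - fps_deriv e" "fps_alt (fps_deriv d) = fps_deriv d"
proof -
  have "fps_alt (fps_deriv a) = - fps_deriv (fps_alt a)" for a
    by (simp add: fps_alt_deriv)
  then show "fps_alt (fps_deriv e) = - fps_deriv e" "fps_alt (fps_deriv d) = fps_deriv d"
    by (simp_all add: gauss_alt)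
qed

lemma \<Theta>_Np: "\<Theta> Np = (P (w * fps_deriv (e + d)) + Qp (- (w * fps_deriv g) - w * e * fps_deriv d)) * Np"
proof -
  have 1: "\<Theta> (E (P e)) = P (w * fps_deriv e) * E (P e)" "\<Theta> (E (P d)) = P (w * fps_deriv d) * E (P d)"
    by (rule \<Theta>_E_P, unfold comm_P_P, rule Qp_even, simp add: fps_alt_simps gauss_alt gauss_deriv_alt)+
  have 2: "\<Theta> (E (Qp (- g))) = Qp (- (w * fps_deriv g)) * E (Qp (- g))"
    by (subst coeffwise_expQ) (simp_all add: \<Theta>_series fps_expQ_comm_0 comm_series_0)
  have 3: "Qp (e * fps_alt (w * fps_deriv d)) = Qp (- (w * e * fps_deriv d))"
    by (simp add: fps_alt_simps gauss_deriv_alt mult_ac)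
  have "\<Theta> Np = E (P e) * (E (Qp (- g)) * P (w * fps_deriv d)) * E (P d)
      + E (P e) * Qp (- (w * fps_deriv g)) * E (Qp (- g)) * E (P d) + P (w * fps_deriv e) * Np"
    unfolding Np_def by (simp add: coeffwise_mult 1 2 distrib_left distrib_right mult.assoc)
  also have "\<dots> = E (P e) * P (w * fps_deriv d) * E (Qp (- g)) * E (P d)
      + E (P e) * Qp (- (w * fps_deriv g)) * E (Qp (- g)) * E (P d) + P (w * fps_deriv e) * Np"
    by (simp only: push_X_P mult.assoc)
  also have "\<dots> = (P (w * fps_deriv (e + d)) + Qp (- (w * fps_deriv g) - w * e * fps_deriv d)) * Np"
    by (simp only: push_even_P push_even_X 3)
      (simp add: distrib_left distrib_right mult.assoc Np_def series_linear left_diff_distrib)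
  finally show ?thesis .
qed

text \<open>The \<open>x^+\<close> and \<open>X^+\<close> terms created by moving \<open>M 1\<close>
  to the left through \<open>Np\<close> are exactly the logarithmic derivative of
  \<open>Np\<close>.\<close>

lemma Np_M_\<Theta>: "Np * M 1 = (M 1 + K (w * (e + d))) * Np + \<Theta> Np"
proof -
  have P: "- (3 * (w * e ^ 2)) - 2 * (w * d * e) - w * d ^ 2 + 4 * (w * g) = w * fps_deriv (e + d)"
    using gauss_eq_P by algebra
  have Q: "w * e ^ 3 + w * d ^ 2 * e + 4 * (w * d * g) = - (w * fps_deriv g) - w * e * fps_deriv d"
    using gauss_eq_X by algebra
  show ?thesis unfolding Np_M \<Theta>_Np P Q by (simp add: distrib_right add.assoc)
qed

text \<open>The term from the odd factor has to cross \<open>E (M e)\<close>, which produces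
  \<open>X^-\<close> terms; these cancel against the derivative of the middle factor.\<close>

lemma \<Theta>_Nm: "\<Theta> Nm = Nm * M (e + d + w * fps_deriv (e + d))"
proof -
  let ?d' = "d + w * fps_deriv d"
  have d': "fps_alt ?d' = - ?d'"
    by (simp add: fps_alt_simps gauss_alt gauss_deriv_alt)
  have 1: "\<Theta> (E (M d)) = E (M d) * M ?d'"
    by (subst coeffwise_expQ)
      (simp_all add: \<Theta>_series comm_M_M Qm_even fps_alt_simps gauss_alt gauss_deriv_alt algebra_simps)
  have 2: "\<Theta> (E (M e)) = E (M e) * M (e + w * fps_deriv e)"
    by (subst coeffwise_expQ)
      (simp_all add: \<Theta>_series comm_M_M Qm_even fps_alt_simps gauss_alt gauss_deriv_alt algebra_simps)
  have 3: "\<Theta> (E (Qm g)) = E (Qm g) * Qm (2 * g + w * fps_deriv g)"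
    by (subst coeffwise_expQ) (simp_all add: \<Theta>_series comm_series_0)
  have 4: "E (Qm g) * M ?d' = M ?d' * E (Qm g)"
    by (rule fps_expQ_comm_0) (simp_all add: comm_series_0)
  have 5: "E (M e) * Qm a = Qm a * E (M e)" for a
    by (rule fps_expQ_comm_0) (simp_all add: comm_series_0)
  have "E (M e) * M ?d' = (M ?d' + Qm (e * fps_alt ?d')) * E (M e)"
    by (rule fps_expQ_comm_1) (simp_all only: comm_M_M comm_series_0 series_nth_0)
  then have "E (M e) * M ?d' = (M ?d' - Qm (e * ?d')) * E (M e)"
    by (simp only: d' mult_minus_right series_linear(15) add_uminus_conv_diff)
  then have 6: "M ?d' * E (M e) = E (M e) * (M ?d' + Qm (e * ?d'))"
    by (simp add: 5 algebra_simps)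
  have "\<Theta> Nm = E (M d) * E (Qm g) * E (M e) * M (e + w * fps_deriv e)
      + E (M d) * E (Qm g) * (Qm (2 * g + w * fps_deriv g) * E (M e))
      + E (M d) * (M ?d' * E (Qm g)) * E (M e)"
    unfolding Nm_def by (simp only: coeffwise_mult 1 2 3) (simp add: distrib_left distrib_right mult.assoc)
  also have "E (M d) * (M ?d' * E (Qm g)) * E (M e) = E (M d) * E (Qm g) * (M ?d' * E (M e))"
    by (simp only: 4[symmetric] mult.assoc)
  also have "E (M d) * E (Qm g) * E (M e) * M (e + w * fps_deriv e)
      + E (M d) * E (Qm g) * (Qm (2 * g + w * fps_deriv g) * E (M e))
      + E (M d) * E (Qm g) * (M ?d' * E (M e))
    = Nm * (M (e + w * fps_deriv e) + Qm (2 * g + w * fps_deriv g) + (M ?d' + Qm (e * ?d')))"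
    unfolding 6 5[symmetric] Nm_def by (simp only: distrib_left mult.assoc)
  also have "\<dots> = Nm * (M (e + d + w * fps_deriv (e + d)) + Qm (2 * g + w * fps_deriv g + ?d' * e))"
    by (simp add: series_linear algebra_simps)
  also have "\<dots> = Nm * M (e + d + w * fps_deriv (e + d))"
    unfolding gauss_eq_Xm by (simp add: series_linear)
  finally show ?thesis .
qed

text \<open>Each bracket with \<open>K half_log_series\<close> multiplies the coefficient series by
  \<open>h_weight\<close>; the iterated brackets sum to its exponential.\<close>

lemma M_E_K: "M a * E (K half_log_series) = E (K half_log_series) * M (fps_expQ h_weight * a)"
proof -
  define A where "A k = M (h_weight ^ k * a)" for k
  have A: "A k * K half_log_series - K half_log_series * A k = A (Suc k)" for k
    using comm_K_M[of half_log_series "h_weight ^ k * a"]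
    by (simp add: A_def comm_def h_weight_def series_linear algebra_simps)
  have low: "(h_weight ^ k * a) $ n = 0" if "n < k" for k n
    by (rule fps_mult_nth_low[where a = k and b = 0]) (use that fps_power_nth_low[OF h_weight_0] in auto)
  then have low': "A k $ i = 0" if "i < k" for k i
    using that by (simp add: A_def M_def weighted_nth)
  have "(\<Sum>k\<le>n. (1 / fact k) *\<^sub>Q (A k $ n)) = M (fps_expQ h_weight * a) $ n" for n
  proof -
    have "(\<Sum>k\<le>n. (1 / fact k) * (h_weight ^ k * a) $ j) = (fps_expQ h_weight * a) $ j" if "j \<le> n" for j
    proof -
      have "(fps_expQ h_weight * a) $ j = (\<Sum>i=0..j. (\<Sum>k\<le>n. (1 / fact k) * (h_weight ^ k) $ i) * a $ (j - i))"
        unfolding fps_mult_nth using that by (intro sum.cong) (simp_all add: fps_expQ_nth[of _ _ n])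
      also have "\<dots> = (\<Sum>k\<le>n. \<Sum>i=0..j. (1 / fact k) * (h_weight ^ k) $ i * a $ (j - i))"
        unfolding sum_distrib_right by (rule sum.swap)
      finally show ?thesis by (simp add: fps_mult_nth sum_distrib_left mult.assoc)
    qed
    then have "(\<Sum>k\<le>n. (1 / fact k) * (h_weight ^ k * a) $ ((n - 1) div 2)) = (fps_expQ h_weight * a) $ ((n - 1) div 2)"
      by simp
    then show ?thesis
      by (cases "Suc 0 \<le> n \<and> even (n - Suc 0)")
        (auto simp: A_def M_def weighted_nth ratvs.scale_sum_left[symmetric] simp del: even_diff_nat)
  qed
  then have "Abs_fps (\<lambda>n. \<Sum>k\<le>n. (1 / fact k) *\<^sub>Q (A k $ n)) = M (fps_expQ h_weight * a)"
    by (simp add: fps_eq_iff)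
  then show ?thesis
    using mult_fps_expQ[of "K half_log_series" A, OF _ A low'] by (simp add: A_def)
qed

definition gauss_product where "gauss_product = Nm * E (K half_log_series) * Np"

text \<open>The term from \<open>Nm\<close> crosses the diagonal factor and becomes
  \<open>M 1\<close> by \<open>gauss_h_weight\<close>. Together with the \<open>K\<close> term of
  the diagonal factor and \<open>\<Theta> Np\<close> it forms the right side of
  \<open>Np_M_\<Theta>\<close>.\<close>

theorem \<Theta>_gauss_product: "\<Theta> gauss_product = gauss_product * M 1"
proof -
  let ?H = "E (K half_log_series)" and ?\<phi> = "e + d + w * fps_deriv (e + d)"
  have H: "\<Theta> ?H = ?H * K (w * (e + d))"
    by (subst coeffwise_expQ) (simp_all add: \<Theta>_series comm_K_K half_log_series_deriv_gauss)
  have "M ?\<phi> * ?H = ?H * M 1"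
    unfolding M_E_K by (simp only: mult.commute[of _ ?\<phi>] gauss_h_weight)
  then have "\<Theta> gauss_product = Nm * ?H * (M 1 * Np + K (w * (e + d)) * Np + \<Theta> Np)"
    unfolding gauss_product_def
    by (simp only: coeffwise_mult H \<Theta>_Nm) (simp add: distrib_left distrib_right mult.assoc flip: mult.assoc[of "M ?\<phi>"])
  also have "\<dots> = Nm * ?H * (Np * M 1)"
    unfolding Np_M_\<Theta> by (simp add: distrib_right)
  finally show ?thesis by (simp add: gauss_product_def mult.assoc)
qed

lemma \<Theta>_exp_product: "\<Theta> (E (P 1) * E (M 1)) = E (P 1) * E (M 1) * M 1"
proof -
  have "\<Theta> (E (P 1)) = 0" "\<Theta> (E (M 1)) = E (M 1) * M 1"
    by (subst coeffwise_expQ; simp add: \<Theta>_series series_linear comm_M_M comm_eq_0 comm_P_P Qm_even alt.graded_one)+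
  then show ?thesis by (simp add: coeffwise_mult mult.assoc)
qed

end

section \<open>Divided powers of commutators\<close>

lemma fps_expQ_X: "fps_expQ fps_X $ n = (1 / fact n :: rat)"
  by (simp add: fps_expQ_def if_distrib[of "\<lambda>x. _ * x"] cong: if_cong)

lemma fps_expQ_monomial:
  "fps_expQ (Abs_fps (\<lambda>n. if n = Suc k then y else 0)) $ n
    = (if Suc k dvd n then divpow y (n div Suc k) else 0)"
proof -
  have X: "Abs_fps (\<lambda>n. if n = Suc k then y else 0) = fps_graded (Suc k) (\<lambda>n q. q *\<^sub>Q y ^ n) fps_X"
  proof (rule fps_ext)
    fix n
    show "Abs_fps (\<lambda>n. if n = Suc k then y else 0) $ n = fps_graded (Suc k) (\<lambda>n q. q *\<^sub>Q y ^ n) fps_X $ n"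
    proof (cases "Suc k dvd n")
      case True
      then obtain s where "n = Suc k * s" ..
      then show ?thesis by (auto simp: fps_graded_def simp del: mult_Suc mult_Suc_right)
    qed (auto simp: fps_graded_def)
  qed
  have X0: "(fps_X :: rat fps) $ 0 = 0" by simp
  show ?thesis unfolding X graded_hom.graded_expQ[OF graded_hom_power X0, symmetric]
    by (simp add: fps_graded_def fps_expQ_X divpow_def)
qed

text \<open>Commuting coefficients split the exponential into factors \<open>exp(Y_m u^m)\<close>,
  whose coefficients are divided powers; up to degree \<open>n\<close> finitely many factors
  matter.\<close>

lemma fps_expQ_in_fps_over:
  assumes S: "zsubring S" and Y: "Y $ 0 = 0" "\<And>m n. comm (Y $ m) (Y $ n) = 0"
    and div: "\<And>m k. divpow (Y $ m) k \<in> S"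
  shows "fps_expQ Y \<in> fps_over S"
proof -
  let ?T = "\<lambda>k. Abs_fps (\<lambda>n. if n = Suc k then Y $ Suc k else 0)"
  have "fps_expQ Y $ n \<in> S" for n
  proof -
    have "Y $ i = (\<Sum>k<n. ?T k) $ i" if "i \<le> n" for i
      using that Y(1) by (cases i) (simp_all add: fps_sum_nth)
    then have "fps_expQ Y $ n = fps_expQ (\<Sum>k<n. ?T k) $ n"
      by (rule fps_expQ_nth_cong)
    also have "fps_expQ (\<Sum>k<n. ?T k) = prod_list (map (\<lambda>k. fps_expQ (?T k)) [0..<n])"
      by (rule fps_expQ_prod) (simp, rule fps_commute, use Y(2) in \<open>simp add: comm_eq_0\<close>)
    finally have "fps_expQ Y $ n = prod_list (map (\<lambda>k. fps_expQ (?T k)) [0..<n]) $ n" .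
    moreover have "prod_list (map (\<lambda>k. fps_expQ (?T k)) [0..<n]) \<in> fps_over S"
      by (intro zsubring_prod_list[OF zsubring_fps_over[OF S]])
        (auto simp: fps_over_def fps_expQ_monomial div zsubring_zero[OF S])
    ultimately show ?thesis by (simp add: fps_over_def)
  qed
  then show ?thesis by (simp add: fps_over_def)
qed

lemma weighted_expQ_in_fps_over:
  assumes S: "zsubring S" and i: "i > 0" and a: "a \<in> fps_over \<int>"
    and y: "\<And>m n. a $ m \<noteq> 0 \<Longrightarrow> a $ n \<noteq> 0 \<Longrightarrow> comm (y m) (y n) = 0"
    and div: "\<And>n k. divpow (y n) k \<in> S"
  shows "fps_expQ (weighted i y a) \<in> fps_over S"
proof (rule fps_expQ_in_fps_over[OF S])
  show "weighted i y a $ 0 = 0" using i by (simp add: weighted_nth_0)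
  have "comm ((a $ m) *\<^sub>Q y m) ((a $ n) *\<^sub>Q y n) = 0" for m n
    using y[of m n] by (cases "a $ m = 0 \<or> a $ n = 0") (auto simp: comm_def mult.commute)
  moreover have "comm 0 x = 0" "comm x 0 = 0" for x :: 'a
    by (simp_all add: comm_def)
  moreover have "weighted i y a $ m = 0 \<or> (\<exists>n. weighted i y a $ m = (a $ n) *\<^sub>Q y n)" for m
    by (auto simp: weighted_nth)
  ultimately show "comm (weighted i y a $ m) (weighted i y a $ n) = 0" for m n
    by metis
  have "divpow 0 k \<in> S" for k
    by (cases k) (simp_all add: divpow_def zsubring_zero[OF S] zsubring_one[OF S])
  moreover have "divpow ((a $ n) *\<^sub>Q y n) k \<in> S" for n k
    unfolding divpow_scaleQ using a
    by (intro zsubring_scaleQ_Ints[OF S] div) (auto simp: fps_over_def)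
  ultimately show "divpow (weighted i y a $ m) k \<in> S" for m k
    by (simp add: weighted_nth)
qed

lemma divpow_add:
  assumes "x * y = y * x"
  shows "divpow (x + y) n = (\<Sum>i=0..n. divpow x i * divpow y (n - i))"
  using arg_cong[OF expser_add[OF assms], of "\<lambda>F. F $ n"] by (simp add: fps_mult_nth)

text \<open>In the Heisenberg situation \<open>exp(sa) b = (b + sc) exp(sa)\<close>. The formula is
  the coefficient of \<open>s^k\<close> after passing to the k-th divided power of
  \<open>b\<close>.\<close>

lemma divpow_mult_divpow_commutator:
  fixes a b c :: "'a::rat_algebra_1"
  assumes c: "comm a b = c" and ac: "comm a c = 0" and bc: "comm b c = 0"
  shows "divpow a k * divpow b k = (\<Sum>i=0..k. divpow b i * divpow c (k - i) * divpow a i)"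
proof -
  let ?E = "expser a" and ?B = "fps_const b" and ?C = "fps_const c * fps_X"
  define A where "A n = (if n = 0 then b else if n = 1 then - c else 0)" for n :: nat
  have "A n * a - a * A n = A (Suc n)" for n
    using c ac by (auto simp: A_def comm_def)
  from mult_expser[of A, OF this] have "?B * ?E = ?E * Abs_fps (\<lambda>k. (1 / fact k) *\<^sub>Q A k)"
    by (simp add: A_def)
  also have "Abs_fps (\<lambda>k. (1 / fact k) *\<^sub>Q A k) = ?B - ?C"
  proof (rule fps_ext)
    fix n
    show "Abs_fps (\<lambda>k. (1 / fact k) *\<^sub>Q A k) $ n = (?B - ?C) $ n"
      by (cases "n = 0"; cases "n = 1") (auto simp: A_def)
  qed
  finally have "?E * ?B = ?B * ?E + ?E * ?C"
    by (simp add: algebra_simps)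
  also have "?E * ?C = ?C * ?E"
  proof -
    have "?E * fps_const c = fps_const c * ?E"
      using ac by (intro expser_commute) (simp add: comm_eq_0)
    then have "?E * ?C = fps_const c * (?E * fps_X)"
      by (simp add: mult.assoc[symmetric])
    then show ?thesis by (simp add: mult.assoc fps_mult_fps_X_commute)
  qed
  finally have EB: "?E * ?B = (?B + ?C) * ?E" by (simp add: distrib_right)
  have "?E * ?B ^ n = (?B + ?C) ^ n * ?E" for n
  proof (induction n)
    case (Suc n)
    have "?E * ?B ^ Suc n = ?E * ?B ^ n * ?B" by (simp only: power_Suc2 mult.assoc)
    also have "\<dots> = (?B + ?C) ^ n * (?E * ?B)" by (simp only: Suc mult.assoc)
    also have "\<dots> = (?B + ?C) ^ Suc n * ?E" by (simp only: EB power_Suc2 mult.assoc)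
    finally show ?case .
  qed simp
  then have "?E * divpow ?B k = divpow (?B + ?C) k * ?E"
    by (simp add: divpow_def)
  also have "divpow (?B + ?C) k = (\<Sum>i=0..k. divpow ?B i * divpow ?C (k - i))"
  proof (rule divpow_add)
    show "?B * ?C = ?C * ?B"
      using bc by (simp add: comm_eq_0 fps_eq_iff)
  qed
  finally have "?E * divpow ?B k = (\<Sum>i=0..k. divpow ?B i * divpow ?C (k - i)) * ?E" .
  moreover have B: "divpow ?B i = fps_const (divpow b i)" for i
    by (simp add: divpow_def fps_eq_iff fps_const_power)
  moreover have C: "divpow ?C i = fps_const (divpow c i) * fps_X ^ i" for i
  proof -
    have "?C ^ i = fps_const (c ^ i) * fps_X ^ i"
    proof (induction i)
      case (Suc i)
      have "?C ^ Suc i = fps_const c * (fps_X * fps_const (c ^ i)) * fps_X ^ i"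
        by (simp add: Suc mult.assoc)
      also have "fps_X * fps_const (c ^ i) = fps_const (c ^ i) * fps_X"
        by (rule fps_mult_fps_X_commute)
      finally show ?case by (simp add: mult.assoc[symmetric])
    qed simp
    then show ?thesis by (simp add: divpow_def fps_eq_iff)
  qed
  ultimately have "(?E * fps_const (divpow b k)) $ k
      = ((\<Sum>i=0..k. fps_const (divpow b i) * (fps_const (divpow c (k - i)) * fps_X ^ (k - i))) * ?E) $ k"
    by (simp only: B C)
  then show ?thesis
    by (simp add: sum_distrib_right fps_sum_nth mult.assoc fps_X_power_mult_nth)
      (auto intro!: sum.cong)
qed

text \<open>With equal exponents on the left, the summand \<open>i = 0\<close> is
  \<open>divpow c k\<close> alone, and the others contain only smaller divided powers of
  \<open>c\<close>.\<close>

lemma divpow_commutator_mem: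
  fixes a b c :: "'a::rat_algebra_1"
  assumes S: "zsubring S" and c: "comm a b = c" and ac: "comm a c = 0" and bc: "comm b c = 0"
    and div: "\<And>k. divpow a k \<in> S" "\<And>k. divpow b k \<in> S"
  shows "divpow c k \<in> S"
proof (induction k rule: less_induct)
  case (less k)
  have "divpow c k = divpow a k * divpow b k - (\<Sum>i\<in>{1..k}. divpow b i * divpow c (k - i) * divpow a i)"
    by (subst divpow_mult_divpow_commutator[OF c ac bc]) (simp add: sum.atLeast_Suc_atMost)
  also have "\<dots> \<in> S"
    using less by (intro zsubring_diff[OF S] zsubring_mult[OF S] zsubring_sum[OF S] div) auto
  finally show ?case .
qed

section \<open>Series in two variables with integral coefficients\<close>

lemma fps_over_mult:
  assumes "\<And>a b. a \<in> A \<Longrightarrow> b \<in> B \<Longrightarrow> a * b \<in> C"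
    and "0 \<in> C" "\<And>x y. x \<in> C \<Longrightarrow> y \<in> C \<Longrightarrow> x + y \<in> C"
    and "F \<in> fps_over A" "G \<in> fps_over B"
  shows "F * G \<in> fps_over (C :: 'a::ring_1 set)"
proof -
  have "(\<Sum>i\<in>I. f i) \<in> C" if "\<And>i. i \<in> I \<Longrightarrow> f i \<in> C" for f and I :: "nat set"
    using that by (induction I rule: infinite_finite_induct) (simp_all add: assms)
  then show ?thesis using assms(1,4,5) by (simp add: fps_over_def fps_mult_nth)
qed

lemma zspan_add:
  assumes "a \<in> zspan S" "b \<in> zspan S"
  shows "a + b \<in> zspan S"
  using zspan.diff[OF assms(1) zspan.diff[OF zspan.zero assms(2)]] by simp

lemma fps_over2_zprod:
  assumes "F \<in> fps_over (fps_over A)" "G \<in> fps_over (fps_over B)"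
  shows "F * G \<in> fps_over (fps_over (zprod A B))"
proof (rule fps_over_mult[OF _ _ _ assms])
  have "zprod A B = zspan {a * b |a b. a \<in> A \<and> b \<in> B}" by (simp add: zprod_def)
  then have z: "0 \<in> zprod A B" "\<And>x y. x \<in> zprod A B \<Longrightarrow> y \<in> zprod A B \<Longrightarrow> x + y \<in> zprod A B"
    by (simp_all add: zspan.zero zspan_add)
  then show "0 \<in> fps_over (zprod A B)"
    "\<And>x y. x \<in> fps_over (zprod A B) \<Longrightarrow> y \<in> fps_over (zprod A B) \<Longrightarrow> x + y \<in> fps_over (zprod A B)"
    by (simp_all add: fps_over_def)
  have "a * b \<in> zprod A B" if "a \<in> A" "b \<in> B" for a b
    unfolding zprod_def using that by (intro zspan.base) auto
  then show "a * b \<in> fps_over (zprod A B)" if "a \<in> fps_over A" "b \<in> fps_over B" for a b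
    using that z by (intro fps_over_mult[of A B]) auto
qed

section \<open>The loop variable \<open>p\<close> and its Euler derivation\<close>

definition fps_monom :: "nat \<Rightarrow> 'a::zero \<Rightarrow> 'a fps" where
  "fps_monom n a = Abs_fps (\<lambda>m. if m = n then a else 0)"

lemma fps_monom_nth: "fps_monom n a $ m = (if m = n then a else 0)"
  by (simp add: fps_monom_def)

lemma fps_monom_0 [simp]: "fps_monom n 0 = 0"
  by (simp add: fps_monom_def fps_eq_iff)

lemma fps_monom_mult: "fps_monom m a * fps_monom n b = fps_monom (m + n) (a * b :: 'a::semiring_0)"
proof (rule fps_ext)
  fix k
  have "(\<Sum>i=0..k. fps_monom m a $ i * fps_monom n b $ (k - i)) = (\<Sum>i=0..k. if i = m then a * fps_monom n b $ (k - m) else 0)"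
    by (rule sum.cong) (auto simp: fps_monom_nth)
  then show "(fps_monom m a * fps_monom n b) $ k = fps_monom (m + n) (a * b) $ k"
    by (auto simp: fps_mult_nth fps_monom_nth)
qed

lemma fps_monom_power: "fps_monom n a ^ k = fps_monom (n * k) (a ^ k :: 'a::semiring_1)"
proof (induction k)
  case 0
  show ?case by (simp add: fps_eq_iff fps_monom_nth)
qed (simp add: fps_monom_mult)

lemma fps_monom_linear:
  "fps_monom n (a + b) = fps_monom n a + fps_monom n (b::'a::rat_algebra_1)"
  "fps_monom n (a - b) = fps_monom n a - fps_monom n b" "fps_monom n (q *\<^sub>Q a) = q *\<^sub>Q fps_monom n a"
  "fps_monom n (- a) = - fps_monom n a"
  by (simp_all add: fps_eq_iff fps_monom_nth)

lemma comm_fps_monom: "comm (fps_monom m a) (fps_monom n b) = fps_monom (m + n) (comm a (b::'a::rat_algebra_1))"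
  by (simp add: comm_def fps_monom_mult fps_monom_linear add.commute)

lemma divpow_fps_monom: "divpow (fps_monom n a) k = fps_monom (n * k) (divpow (a::'a::rat_algebra_1) k)"
  by (simp add: divpow_def fps_monom_power fps_monom_linear)

definition euler :: "'a::rat_algebra_1 fps \<Rightarrow> 'a fps" where
  "euler F = Abs_fps (\<lambda>m. of_nat m *\<^sub>Q (F $ m))"

lemma euler_nth [simp]: "euler F $ m = of_nat m *\<^sub>Q (F $ m)"
  by (simp add: euler_def)

lemma euler_fps_monom: "euler (fps_monom n a) = of_nat n *\<^sub>Q fps_monom n a"
  by (simp add: fps_eq_iff fps_monom_nth)

interpretation euler: algebra_derivation euler
proof
  fix F G :: "'a fps"
  have euler: "euler H = fps_X * fps_deriv H" for H :: "'a fps"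
    by (simp add: fps_mult_fps_X_deriv_shift euler_def scaleQ_of_nat)
  have "fps_X * (F * fps_deriv G) = F * (fps_X * fps_deriv G)"
    by (metis fps_mult_fps_X_commute mult.assoc)
  then show "euler (F * G) = F * euler G + euler F * G"
    by (simp only: euler fps_deriv_mult distrib_left mult.assoc)
qed (simp_all add: fps_eq_iff scaleQ_add_right mult.commute)

text \<open>As \<open>A\<close> has no term free of \<open>p\<close>, the coefficient of
  \<open>p^l\<close> on the right involves only lower ones of \<open>F\<close>, while the left side
  multiplies by \<open>l\<close>. So the value at \<open>p = 0\<close> determines the
  solution.\<close>

lemma euler_unique:
  fixes F G A :: "'a::rat_algebra_1 fps fps"
  assumes F: "coeffwise euler F = F * A" and G: "coeffwise euler G = G * A"
    and A: "\<And>n. A $ n $ 0 = 0" and 0: "\<And>n. F $ n $ 0 = G $ n $ 0"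
  shows "F = G"
proof -
  have "F $ n $ l = G $ n $ l" for n l
  proof (induction l arbitrary: n rule: less_induct)
    case (less l)
    show ?case
    proof (cases "l = 0")
      case False
      have "(F * A) $ n $ l = (G * A) $ n $ l"
        unfolding fps_mult_nth[of _ A] fps_sum_nth fps_mult_nth
      proof (intro sum.cong refl)
        fix i j assume "i \<in> {0..n}" "j \<in> {0..l}"
        then show "F $ i $ j * A $ (n - i) $ (l - j) = G $ i $ j * A $ (n - i) $ (l - j)"
          using less A by (cases "j = l") auto
      qed
      then have "of_nat l *\<^sub>Q (F $ n $ l) = of_nat l *\<^sub>Q (G $ n $ l)"
        by (simp flip: F G)
      then show ?thesis using False by simp
    qed (simp add: 0)
  qed
  then show ?thesis by (simp add: fps_eq_iff)
qed

abbreviation X_elt :: "pm \<Rightarrow> int \<Rightarrow> ualg" where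
  "X_elt \<sigma> s \<equiv> ugen (GBigX \<sigma> ((s - 1) div 2))"

lemma comm_relations:
  "comm (x_elt \<sigma> r) (x_elt \<sigma> s) = (if even (r + s) then 0 else (sg \<sigma> * (-1) powi s) *\<^sub>Q X_elt \<sigma> (r + s))"
  "r + s \<noteq> 0 \<Longrightarrow> comm (x_elt Pos r) (x_elt Neg s) = h_elt (r + s)"
  "odd s \<Longrightarrow> comm (h_elt r) (X_elt \<sigma> s) = (if even r then (sg \<sigma> * 4) *\<^sub>Q X_elt \<sigma> (r + s) else 0)"
  "odd s \<Longrightarrow> comm (x_elt \<sigma> r) (X_elt \<sigma> s) = 0"
  "odd r \<Longrightarrow> odd s \<Longrightarrow> comm (X_elt \<sigma> r) (X_elt \<sigma> s) = 0"
  "odd s \<Longrightarrow> comm (x_elt \<sigma> r) (X_elt (opp \<sigma>) s) = (sg \<sigma> * (-1) powi r * 4) *\<^sub>Q x_elt (opp \<sigma>) (r + s)"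
  using abs_ualg_relator[OF relators.x_x[of \<sigma> r s]] abs_ualg_relator[OF relators.xp_xm[of r s]]
    abs_ualg_relator[OF relators.h_X[of s r \<sigma>]] abs_ualg_relator[OF relators.x_X[of s \<sigma> r]]
    abs_ualg_relator[OF relators.X_X[of r s \<sigma>]] abs_ualg_relator[OF relators.x_Xopp[of s \<sigma> r]]
  by (simp_all add: abs_ualg_simps comm_def split: if_splits)

text \<open>
  The value 0 at even indices makes the structure constants of the loop algebra combinations of
  the signs \<open>(-1) ^ r\<close> and \<open>(-1) ^ s\<close>, as \<open>comm_weighted\<close> requires.
\<close>

definition X_loop :: "pm \<Rightarrow> nat \<Rightarrow> ualg fps" where
  "X_loop \<sigma> n = (if odd n then fps_monom n (X_elt \<sigma> (int n)) else 0)"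

lemma powi_pred: "(-1) powi (int r - 1) = - ((-1) ^ r :: rat)"
  by (simp add: power_int_diff)

interpretation loops: a22_positive_half euler
  "\<lambda>n. fps_monom n (x_elt Pos (int n))" "\<lambda>n. fps_monom n (x_elt Neg (int n))"
  "\<lambda>n. fps_monom n (h_elt (int n))" "X_loop Pos" "X_loop Neg"
proof
  fix r s :: nat
  show "comm (fps_monom r (x_elt Pos (int r))) (fps_monom (Suc s) (x_elt Neg (int (Suc s)))) = fps_monom (Suc (r + s)) (h_elt (int (Suc (r + s))))"
    using comm_relations(2)[of "int r" "int (Suc s)"] by (simp add: comm_fps_monom add_ac)
  show "comm (fps_monom r (h_elt (int r))) (fps_monom s (x_elt Pos (int s))) = (4 - 2 * (-1) ^ r) *\<^sub>Q fps_monom (r + s) (x_elt Pos (int (r + s)))"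
    "comm (fps_monom r (h_elt (int r))) (fps_monom s (x_elt Neg (int s))) = (2 * (-1) ^ r - 4) *\<^sub>Q fps_monom (r + s) (x_elt Neg (int (r + s)))"
    by (simp_all add: comm_fps_monom comm_h_x fps_monom_linear powi_pred algebra_simps)
  show "comm (fps_monom r (h_elt (int r))) (fps_monom s (h_elt (int s))) = 0"
    using comm_h_h[of "int r" "int s"] by (cases "r + s = 0") (simp_all add: comm_fps_monom, simp add: comm_def)
  show "comm (fps_monom r (h_elt (int r))) (X_loop Pos s) = (2 + 2 * (-1) ^ r) *\<^sub>Q X_loop Pos (r + s)"
    using comm_relations(3)[of "int s" "int r" Pos]
    by (auto simp: X_loop_def comm_fps_monom fps_monom_linear) (simp_all add: comm_def)
  show "comm (fps_monom r (x_elt Pos (int r))) (fps_monom s (x_elt Pos (int s))) = (-1) ^ s *\<^sub>Q X_loop Pos (r + s)"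
    "comm (fps_monom r (x_elt Neg (int r))) (fps_monom s (x_elt Neg (int s))) = - ((-1) ^ s) *\<^sub>Q X_loop Neg (r + s)"
    using comm_relations(1)[of _ "int r" "int s"]
    by (auto simp: X_loop_def comm_fps_monom fps_monom_linear)
  show "comm (fps_monom r (x_elt Neg (int r))) (X_loop Pos s) = (2 * (-1) ^ (r + s) - 2 * (-1) ^ r) *\<^sub>Q fps_monom (r + s) (x_elt Pos (int (r + s)))"
    using comm_relations(6)[of "int s" Neg "int r"]
    by (auto simp: X_loop_def comm_fps_monom fps_monom_linear power_add) (simp_all add: comm_def)
  show "comm (fps_monom r (x_elt Pos (int r))) (X_loop Pos s) = 0"
    "comm (fps_monom r (x_elt Neg (int r))) (X_loop Neg s) = 0"
    using comm_relations(4)[of "int s" _ "int r"]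
    by (auto simp: X_loop_def comm_fps_monom) (simp_all add: comm_def)
  show "comm (X_loop Pos r) (X_loop Pos s) = 0" "comm (X_loop Neg r) (X_loop Neg s) = 0"
    using comm_relations(5)[of "int r" "int s"]
    by (auto simp: X_loop_def comm_fps_monom) (simp_all add: comm_def)
qed (simp_all add: X_loop_def euler_fps_monom euler.\<delta>_0)

section \<open>Integrality of the factors\<close>

abbreviation const_coeff :: "'a::rat_algebra_1 fps fps \<Rightarrow> 'a fps" where
  "const_coeff \<equiv> fps_graded (Suc 0) (\<lambda>_ F. F $ 0)"

interpretation const_coeff: graded_hom "Suc 0" "\<lambda>_ (F :: 'a::rat_algebra_1 fps). F $ 0"
  by unfold_locales simp_all

text \<open>At \<open>p = 0\<close> the series in \<open>x^-\<close>, \<open>X\<close> and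
  \<open>h\<close> vanish, and \<open>P a\<close> retains only the constant term of
  \<open>a\<close>, which is 1 for \<open>gauss_even\<close> and 0 for \<open>gauss_odd\<close>.
  Both sides then are \<open>exp(x_0^+ u)\<close>.\<close>

lemma exp_product_eq_gauss_product:
  "fps_expQ (loops.P 1) * fps_expQ (loops.M 1) = loops.gauss_product"
proof (rule euler_unique[OF loops.\<Theta>_exp_product loops.\<Theta>_gauss_product])
  have nth: "const_coeff F $ n = F $ n $ 0" for F :: "ualg fps fps" and n
    by (simp add: fps_graded_def)
  have M: "const_coeff (loops.M a) = 0" for a
    by (rule fps_ext) (simp add: nth loops.M_def weighted_nth fps_monom_nth)
  have Q: "const_coeff (loops.Qp a) = 0" "const_coeff (loops.Qm a) = 0" for a
    by (rule fps_ext, simp add: nth loops.Qp_def loops.Qm_def weighted_nth fps_monom_nth X_loop_def)+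
  have K: "const_coeff (loops.K half_log_series) = 0"
    by (rule fps_ext) (simp add: nth loops.K_def weighted_nth fps_monom_nth)
  have P: "const_coeff (loops.P a) = (a $ 0) *\<^sub>Q const_coeff (loops.P 1)" for a
    by (rule fps_ext) (simp add: nth loops.P_def weighted_nth fps_monom_nth)
  have "gauss_inv $ 0 = 1" by (simp add: gauss_inv_def)
  then have "gauss_even $ 0 = 1" "gauss_odd $ 0 = 0"
    by (simp_all add: gauss_even_def gauss_odd_def)
  then have "const_coeff (loops.P gauss_even) = const_coeff (loops.P 1)"
    "const_coeff (loops.P gauss_odd) = 0"
    using P[of gauss_even] P[of gauss_odd] by simp_all
  then have "const_coeff (fps_expQ (loops.P 1) * fps_expQ (loops.M 1)) = const_coeff loops.gauss_product"
    by (simp add: loops.gauss_product_def loops.Nm_def loops.Np_def const_coeff.graded_mult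
        const_coeff.graded_expQ M Q K)
  then show "(fps_expQ (loops.P 1) * fps_expQ (loops.M 1)) $ n $ 0 = loops.gauss_product $ n $ 0" for n
    by (simp only: nth[symmetric])
  show "loops.M 1 $ n $ 0 = 0" for n
    by (simp add: loops.M_def weighted_nth fps_monom_nth)
qed

lemma zsubring_UZ_pm: "zsubring (UZ_pm \<sigma>)"
  unfolding UZ_pm_def by (rule zsubring_zsubalg)

lemma divpow_x_in_UZ_pm: "divpow (x_elt \<sigma> r) k \<in> UZ_pm \<sigma>"
  unfolding UZ_pm_def by (rule zsubalg.base) auto

text \<open>For odd \<open>s\<close>, up to sign \<open>X_s\<close> is the bracket of
  \<open>x_s\<close> and \<open>x_0\<close> and commutes with both.\<close>

lemma divpow_X_in_UZ_pm:
  assumes "odd s"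
  shows "divpow (X_elt \<sigma> s) k \<in> UZ_pm \<sigma>"
proof -
  let ?c = "sg \<sigma> *\<^sub>Q X_elt \<sigma> s"
  have sg: "sg \<sigma> ^ k * sg \<sigma> ^ k = 1" "sg \<sigma> ^ k \<in> \<int>" for k
    by (cases \<sigma>; simp flip: power_mult_distrib)+
  have "divpow ?c k \<in> UZ_pm \<sigma>"
  proof (rule divpow_commutator_mem[OF zsubring_UZ_pm])
    show "comm (x_elt \<sigma> s) (x_elt \<sigma> 0) = ?c"
      using assms by (simp add: comm_relations)
    have "comm (x_elt \<sigma> r) (X_elt \<sigma> s) = 0" for r
      using assms by (simp add: comm_relations)
    then show "comm (x_elt \<sigma> s) ?c = 0" "comm (x_elt \<sigma> 0) ?c = 0"
      by (simp_all add: comm_def)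
  qed (rule divpow_x_in_UZ_pm)+
  from zsubring_scaleQ_Ints[OF zsubring_UZ_pm sg(2) this, of k] show ?thesis
    by (simp add: divpow_scaleQ sg(1))
qed

lemma divpow_0_left_in: "zsubring S \<Longrightarrow> divpow 0 k \<in> S"
  by (cases k) (simp_all add: divpow_def zsubring_zero zsubring_one)

lemma fps_monom_in_fps_over: "zsubring S \<Longrightarrow> a \<in> S \<Longrightarrow> fps_monom n a \<in> fps_over S"
  by (simp add: fps_over_def fps_monom_nth zsubring_zero)

lemma divpow_loops_in_fps_over:
  "divpow (fps_monom n (x_elt \<sigma> r)) k \<in> fps_over (UZ_pm \<sigma>)"
  "divpow (X_loop \<sigma> n) k \<in> fps_over (UZ_pm \<sigma>)"
  by (auto simp: X_loop_def divpow_fps_monom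
      intro!: fps_monom_in_fps_over zsubring_UZ_pm divpow_x_in_UZ_pm divpow_X_in_UZ_pm
        divpow_0_left_in zsubring_fps_over)

lemma comm_x_same_parity:
  "even (r + s) \<Longrightarrow> comm (fps_monom m (x_elt \<sigma> r)) (fps_monom n (x_elt \<sigma> s)) = 0"
  by (simp add: comm_fps_monom comm_relations)

lemma gauss_parity:
  "gauss_even $ n \<noteq> 0 \<Longrightarrow> even n" "gauss_odd $ n \<noteq> 0 \<Longrightarrow> odd n"
  using arg_cong[OF gauss_alt(2), of "\<lambda>F. F $ n"] arg_cong[OF gauss_alt(3), of "\<lambda>F. F $ n"]
  by (cases "even n"; simp)+

text \<open>By parity, \<open>gauss_even\<close> selects only even indices and
  \<open>gauss_odd\<close> only odd ones, so the \<open>x\<close> inside each exponential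
  commute.\<close>

lemma Np_integral: "loops.Np \<in> fps_over (fps_over (UZ_pm Pos))"
proof -
  have S: "zsubring (fps_over (UZ_pm Pos))" by (intro zsubring_fps_over zsubring_UZ_pm)
  show ?thesis unfolding loops.Np_def loops.P_def loops.Qp_def
    by (intro zsubring_mult[OF zsubring_fps_over[OF S]] weighted_expQ_in_fps_over[OF S]
        divpow_loops_in_fps_over comm_x_same_parity gauss_integral fps_Ints_intros loops.Xp_Xp)
      (auto dest: gauss_parity)
qed

lemma Nm_integral: "loops.Nm \<in> fps_over (fps_over (UZ_pm Neg))"
proof -
  have S: "zsubring (fps_over (UZ_pm Neg))" by (intro zsubring_fps_over zsubring_UZ_pm)
  show ?thesis unfolding loops.Nm_def loops.M_def loops.Qm_def
    by (intro zsubring_mult[OF zsubring_fps_over[OF S]] weighted_expQ_in_fps_over[OF S]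
        divpow_loops_in_fps_over comm_x_same_parity gauss_integral fps_Ints_intros loops.Xm_Xm)
      (auto dest: gauss_parity)
qed

lemma hhat_d_in_UZ_0: "hhat_d n \<in> UZ_0"
proof -
  have "x \<in> UZ_0" if "x \<in> zsubalg {htilde_pos k | k. k > 0}" for x
    using that unfolding UZ_0_def by (induction rule: zsubalg.induct) (auto intro: zsubalg.intros)
  then show ?thesis using hhat_d_integral by blast
qed

text \<open>Attaching \<open>p^n z^(2n)\<close> to \<open>h_n\<close> carries the generating series
  of the \<open>hhat_d n\<close> to the diagonal factor.\<close>

lemma K_integral: "fps_expQ (loops.K half_log_series) \<in> fps_over (fps_over UZ_0)"
proof -
  interpret graded_hom 2 "fps_monom :: nat \<Rightarrow> ualg \<Rightarrow> ualg fps"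
    by unfold_locales (simp_all add: fps_monom_linear fps_monom_mult, simp add: fps_eq_iff fps_monom_nth)
  let ?Y = "Abs_fps (\<lambda>n. (half_log_series $ n) *\<^sub>Q h_elt (int n))"
  have UZ: "zsubring UZ_0" unfolding UZ_0_def by (rule zsubring_zsubalg)
  have "half_log_series $ n = (if n = 0 then 0 else (-1) ^ (n - 1) * d_seq n / of_nat n)" for n
    using arg_cong[OF d_seq_generating, of "\<lambda>F. F $ n"] by simp
  then have "?Y = Abs_fps (\<lambda>r. if r = 0 then 0 else ((-1) ^ (r - 1) * d_seq r / of_nat r) *\<^sub>Q h_elt (int r))"
    by (simp add: fps_eq_iff)
  then have "hhat_d n = fps_expQ ?Y $ n" for n
    by (simp add: hhat_d_def hhat_def)
  then have "fps_expQ ?Y \<in> fps_over UZ_0"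
    by (simp add: fps_over_def hhat_d_in_UZ_0[unfolded \<open>\<And>n. hhat_d n = fps_expQ ?Y $ n\<close>])
  then have "fps_graded 2 fps_monom (fps_expQ ?Y) \<in> fps_over (fps_over UZ_0)"
    by (rule graded_integral[OF zsubring_fps_over[OF UZ]]) (rule fps_monom_in_fps_over[OF UZ])
  also have "fps_graded 2 fps_monom (fps_expQ ?Y) = fps_expQ (fps_graded 2 fps_monom ?Y)"
    by (rule graded_expQ) simp
  also have "fps_graded 2 fps_monom ?Y = loops.K half_log_series"
    by (rule fps_ext) (simp add: loops.K_def weighted_nth fps_graded_def fps_monom_linear)
  finally show ?thesis .
qed

text \<open>The monomial \<open>u^k v^l\<close> is \<open>z^(k+l) p^l\<close>, so a single term of
  the Cauchy product survives.\<close>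

lemma exp_product_nth:
  "(fps_expQ (loops.P 1) * fps_expQ (loops.M 1)) $ (k + l) $ l = divpow (x_elt Pos 0) k * divpow (x_elt Neg 1) l"
proof -
  have "weighted 1 y 1 = Abs_fps (\<lambda>n. if n = Suc 0 then y 0 else 0)" for y :: "nat \<Rightarrow> ualg fps"
    by (rule fps_ext) (auto simp: weighted_nth elim!: oddE evenE)
  then have E: "fps_expQ (weighted 1 y 1) $ n = divpow (y 0) n" for y :: "nat \<Rightarrow> ualg fps" and n
    by (simp add: fps_expQ_monomial)
  have "(fps_expQ (loops.P 1) * fps_expQ (loops.M 1)) $ (k + l) $ l
      = (\<Sum>i=0..k + l. (divpow (fps_monom 0 (x_elt Pos 0)) i * divpow (fps_monom 1 (x_elt Neg 1)) (k + l - i)) $ l)"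
    by (simp add: fps_mult_nth[of "fps_expQ _"] fps_sum_nth loops.P_def loops.M_def E[unfolded One_nat_def])
  also have "\<dots> = (\<Sum>i=0..k + l. if i = k then divpow (x_elt Pos 0) k * divpow (x_elt Neg 1) l else 0)"
    by (rule sum.cong) (auto simp: divpow_fps_monom fps_monom_mult fps_monom_nth)
  finally show ?thesis by simp
qed

theorem corollary6p39:
  shows "(\<forall>n>0. hhat_d n \<in> zsubalg {htilde_pos k | k. k > 0}) \<and>
    (\<forall>k l. divpow (x_elt Pos 0) k * divpow (x_elt Neg 1) l
       \<in> zprod (zprod (UZ_pm Neg) UZ_0) (UZ_pm Pos))"
proof (intro conjI allI impI)
  show "hhat_d n \<in> zsubalg {htilde_pos k | k. k > 0}" for n
    by (rule hhat_d_integral)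
  fix k l
  have "loops.gauss_product \<in> fps_over (fps_over (zprod (zprod (UZ_pm Neg) UZ_0) (UZ_pm Pos)))"
    unfolding loops.gauss_product_def
    by (intro fps_over2_zprod Nm_integral K_integral Np_integral)
  then show "divpow (x_elt Pos 0) k * divpow (x_elt Neg 1) l
       \<in> zprod (zprod (UZ_pm Neg) UZ_0) (UZ_pm Pos)"
    unfolding exp_product_nth[symmetric] exp_product_eq_gauss_product by (simp add: fps_over_def)
qed

end
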